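(* Let $\sigma=(s_{i,j})_{1\le i,j\le n}$ be a shift matrix which is upper triangular, i.e. $s_{i,j}=0$ for $i>j$. Then ${}^\sigma C_n(u)=C_n(u)$ as elements of $Y_n[[u^{-1}]]$. In particular, the coefficients of ${}^\sigma C_n(u)$ belong to the center of $Y_n(\sigma)$.
   Context: $F$ is an algebraically closed field of characteristic zero. The Yangian $Y_n$ is the associative $F$-algebra with generators $T_{i,j}^{(r)}$ ($1\le i,j\le n$, $r\ge1$) and relations $[T_{i,j}^{(r)},T_{k,l}^{(s)}]=\sum_{t=0}^{\min(r,s)-1}\big(T_{k,j}^{(t)}T_{i,l}^{(r+s-1-t)}-T_{k,j}^{(r+s-1-t)}T_{i,l}^{(t)}\big)$, where $T_{i,j}^{(0)}:=\delta_{i,j}$. Let $T_{i,j}(u)=\sum_{r\ge0}T_{i,j}^{(r)}u^{-r}\in Y_n[[u^{-1}]]$ and let $T(u)$ be the matrix with these entries. It has a unique Gauss factorization $T(u)=F(u)D(u)E(u)$ with $D(u)$ diagonal with entries $D_i(u)=\sum_{r\ge0}D_i^{(r)}u^{-r}$ ($D_i^{(0)}=1$), $E(u)$ upper unitriangular with $(i,j)$-entry $E_{i,j}(u)=\sum_{r\ge1}E_{i,j}^{(r)}u^{-r}$ for $i<j$, and $F(u)$ lower unitriangular with $(j,i)$-entry $F_{i,j}(u)=\sum_{r\ge1}F_{i,j}^{(r)}u^{-r}$ for $i<j$. A shift matrix is an $n\times n$ matrix $\sigma=(s_{i,j})$ of non-negative integers with $s_{i,j}+s_{j,k}=s_{i,k}$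 whenever $|i-j|+|j-k|=|i-k|$. The shifted Yangian $Y_n(\sigma)$ is the subalgebra of $Y_n$ generated by $D_i^{(r)}$ ($1\le i\le n$, $r>0$), $E_i^{(r)}:=E_{i,i+1}^{(r)}$ ($1\le i<n$, $r>s_{i,i+1}$) and $F_i^{(r)}:=F_{i,i+1}^{(r)}$ ($1\le i<n$, $r>s_{i+1,i}$). For $1\le i<j\le n$ define recursively ${}^\sigma E_{i,i+1}^{(r)}:=E_i^{(r)}$, ${}^\sigma E_{i,j}^{(r)}:=[{}^\sigma E_{i,j-1}^{(r-s_{j-1,j})},E_{j-1}^{(s_{j-1,j}+1)}]$ for $r>s_{i,j}$, and ${}^\sigma F_{i,i+1}^{(r)}:=F_i^{(r)}$, ${}^\sigma F_{i,j}^{(r)}:=[F_{j-1}^{(s_{j,j-1}+1)},{}^\sigma F_{i,j-1}^{(r-s_{j,j-1})}]$ for $r>s_{j,i}$; set ${}^\sigma E_{i,j}(u)=\sum_{r>s_{i,j}}{}^\sigma E_{i,j}^{(r)}u^{-r}$, ${}^\sigma F_{i,j}(u)=\sum_{r>s_{j,i}}{}^\sigma F_{i,j}^{(r)}u^{-r}$, ${}^\sigma E_{i,i}(u)={}^\sigma F_{i,i}(u)=1$, and ${}^\sigma T_{i,j}(u):=\sum_{k=1}^{\min(i,j)}{}^\sigma F_{k,i}(u)D_k(u){}^\sigma E_{k,j}(u)$. For an $n\times n$ matrix $A=(a_{i,j})$ over an associative algebra, $\mathrm{cdet}A:=\sum_{w\in S_n}\mathrm{sgn}(w)a_{w1,1}a_{w2,2}\cdots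 a_{wn,n}$. Define $C_n(u):=\mathrm{cdet}\big(T_{i,j}(u-j+1)\big)_{1\le i,j\le n}$ and ${}^\sigma C_n(u):=\mathrm{cdet}\big({}^\sigma T_{i,j}(u-j+1)\big)_{1\le i,j\le n}$, where series in $u-j+1$ are re-expanded as power series in $u^{-1}$. *)

theory Defs
  imports "HOL-Combinatorics.Permutations" "HOL-Computational_Algebra.Polynomial"
begin

(* A power series  a(u) = sum_{r>=0} a_r u^{-r}  with coefficients in an associative
   ring 'a is represented by its coefficient function  a :: nat => 'a  (a r = a_r). *)

definition sone :: "nat \<Rightarrow> 'a::ring_1" where
  "sone m = (if m = 0 then 1 else 0)"

definition smul :: "(nat \<Rightarrow> 'a::ring_1) \<Rightarrow> (nat \<Rightarrow> 'a) \<Rightarrow> nat \<Rightarrow> 'a" where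
  "smul a b m = (\<Sum>p\<le>m. a p * b (m - p))"

fun sprod_list :: "(nat \<Rightarrow> 'a::ring_1) list \<Rightarrow> nat \<Rightarrow> 'a" where
  "sprod_list [] = sone"
| "sprod_list (x # xs) = smul x (sprod_list xs)"

(* substitution u |-> u - c, re-expanded in u^{-1}:
   a(u-c) = sum_r a_r u^{-r} (1 - c/u)^{-r} = sum_r sum_k a_r binom(r+k-1,k) c^k u^{-r-k} *)
definition sshift :: "nat \<Rightarrow> (nat \<Rightarrow> 'a::ring_1) \<Rightarrow> nat \<Rightarrow> 'a" where
  "sshift c a m = (\<Sum>r\<le>m. a r * of_nat (c ^ (m - r) *
       (if r = 0 then (if m = 0 then 1 else 0) else (m - 1) choose (m - r))))"

definition cdet :: "nat \<Rightarrow> (nat \<Rightarrow> nat \<Rightarrow> nat \<Rightarrow> 'a::ring_1) \<Rightarrow> nat \<Rightarrow> 'a" where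
  "cdet n A m = (\<Sum>w\<in>{w. w permutes {1..n}}.
       of_int (sign w) * sprod_list (map (\<lambda>j. A (w j) j) [1..<Suc n]) m)"

definition Tc :: "(nat \<Rightarrow> nat \<Rightarrow> nat \<Rightarrow> 'a::ring_1) \<Rightarrow> nat \<Rightarrow> nat \<Rightarrow> nat \<Rightarrow> 'a" where
  "Tc t i j r = (if r = 0 then (if i = j then 1 else 0) else t i j r)"

definition yangian_rel :: "nat \<Rightarrow> (nat \<Rightarrow> nat \<Rightarrow> nat \<Rightarrow> 'a::ring_1) \<Rightarrow> bool" where
  "yangian_rel n t \<longleftrightarrow>
     (\<forall>i\<in>{1..n}. \<forall>j\<in>{1..n}. \<forall>k\<in>{1..n}. \<forall>l\<in>{1..n}. \<forall>r s. 1 \<le> r \<longrightarrow> 1 \<le> s \<longrightarrow>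
        Tc t i j r * Tc t k l s - Tc t k l s * Tc t i j r =
        (\<Sum>q<min r s. Tc t k j q * Tc t i l (r + s - 1 - q) - Tc t k j (r + s - 1 - q) * Tc t i l q))"

definition unit_entry :: "(nat \<Rightarrow> nat \<Rightarrow> nat \<Rightarrow> 'a::ring_1) \<Rightarrow> nat \<Rightarrow> nat \<Rightarrow> nat \<Rightarrow> 'a" where
  "unit_entry X k j = (if k = j then sone else X k j)"

(* Gauss factorization T(u) = F(u) D(u) E(u): D i = D_i(u), E i j = E_{i,j}(u) (i<j),
   F i j = F_{i,j}(u) (i<j), the latter being the (j,i)-entry of F(u). *)
definition gauss :: "nat \<Rightarrow> (nat \<Rightarrow> nat \<Rightarrow> nat \<Rightarrow> 'a::ring_1) \<Rightarrow> (nat \<Rightarrow> nat \<Rightarrow> 'a)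
      \<Rightarrow> (nat \<Rightarrow> nat \<Rightarrow> nat \<Rightarrow> 'a) \<Rightarrow> (nat \<Rightarrow> nat \<Rightarrow> nat \<Rightarrow> 'a) \<Rightarrow> bool" where
  "gauss n T D E F \<longleftrightarrow>
     (\<forall>i\<in>{1..n}. D i 0 = 1) \<and>
     (\<forall>i j. 1 \<le> i \<longrightarrow> i < j \<longrightarrow> j \<le> n \<longrightarrow> E i j 0 = 0 \<and> F i j 0 = 0) \<and>
     (\<forall>i\<in>{1..n}. \<forall>j\<in>{1..n}. \<forall>m.
        T i j m = (\<Sum>k=1..min i j. smul (unit_entry F k i) (smul (D k) (unit_entry E k j)) m))"

definition shift_matrix :: "nat \<Rightarrow> (nat \<Rightarrow> nat \<Rightarrow> nat) \<Rightarrow> bool" where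
  "shift_matrix n s \<longleftrightarrow>
     (\<forall>i\<in>{1..n}. \<forall>j\<in>{1..n}. \<forall>k\<in>{1..n}.
        \<bar>int i - int j\<bar> + \<bar>int j - int k\<bar> = \<bar>int i - int k\<bar> \<longrightarrow> s i j + s j k = s i k)"

(* sE_aux s E i d r = {}^sigma E_{i,i+d+1}^{(r)} *)
primrec sE_aux :: "(nat \<Rightarrow> nat \<Rightarrow> nat) \<Rightarrow> (nat \<Rightarrow> nat \<Rightarrow> nat \<Rightarrow> 'a::ring_1) \<Rightarrow> nat \<Rightarrow> nat \<Rightarrow> nat \<Rightarrow> 'a" where
  "sE_aux s E i 0 r = E i (Suc i) r"
| "sE_aux s E i (Suc d) r =
     (let j = i + d + 2; x = sE_aux s E i d (r - s (j - 1) j); y = E (j - 1) j (s (j - 1) j + 1)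
      in x * y - y * x)"

(* sF_aux s F i d r = {}^sigma F_{i,i+d+1}^{(r)} *)
primrec sF_aux :: "(nat \<Rightarrow> nat \<Rightarrow> nat) \<Rightarrow> (nat \<Rightarrow> nat \<Rightarrow> nat \<Rightarrow> 'a::ring_1) \<Rightarrow> nat \<Rightarrow> nat \<Rightarrow> nat \<Rightarrow> 'a" where
  "sF_aux s F i 0 r = F i (Suc i) r"
| "sF_aux s F i (Suc d) r =
     (let j = i + d + 2; x = sF_aux s F i d (r - s j (j - 1)); y = F (j - 1) j (s j (j - 1) + 1)
      in y * x - x * y)"

definition sEser :: "(nat \<Rightarrow> nat \<Rightarrow> nat) \<Rightarrow> (nat \<Rightarrow> nat \<Rightarrow> nat \<Rightarrow> 'a::ring_1) \<Rightarrow> nat \<Rightarrow> nat \<Rightarrow> nat \<Rightarrow> 'a" where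
  "sEser s E i j r = (if i = j then sone r
      else if i < j \<and> s i j < r then sE_aux s E i (j - i - 1) r else 0)"

definition sFser :: "(nat \<Rightarrow> nat \<Rightarrow> nat) \<Rightarrow> (nat \<Rightarrow> nat \<Rightarrow> nat \<Rightarrow> 'a::ring_1) \<Rightarrow> nat \<Rightarrow> nat \<Rightarrow> nat \<Rightarrow> 'a" where
  "sFser s F i j r = (if i = j then sone r
      else if i < j \<and> s j i < r then sF_aux s F i (j - i - 1) r else 0)"

definition sT :: "(nat \<Rightarrow> nat \<Rightarrow> nat) \<Rightarrow> (nat \<Rightarrow> nat \<Rightarrow> 'a::ring_1) \<Rightarrow> (nat \<Rightarrow> nat \<Rightarrow> nat \<Rightarrow> 'a)
      \<Rightarrow> (nat \<Rightarrow> nat \<Rightarrow> nat \<Rightarrow> 'a) \<Rightarrow> nat \<Rightarrow> nat \<Rightarrow> nat \<Rightarrow> 'a" where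
  "sT s D E F i j m = (\<Sum>k=1..min i j. smul (sFser s F k i) (smul (D k) (sEser s E k j)) m)"

definition Cn :: "nat \<Rightarrow> (nat \<Rightarrow> nat \<Rightarrow> nat \<Rightarrow> 'a::ring_1) \<Rightarrow> nat \<Rightarrow> 'a" where
  "Cn n T = cdet n (\<lambda>i j. sshift (j - 1) (T i j))"

definition sCn :: "nat \<Rightarrow> (nat \<Rightarrow> nat \<Rightarrow> nat) \<Rightarrow> (nat \<Rightarrow> nat \<Rightarrow> 'a::ring_1) \<Rightarrow> (nat \<Rightarrow> nat \<Rightarrow> nat \<Rightarrow> 'a)
      \<Rightarrow> (nat \<Rightarrow> nat \<Rightarrow> nat \<Rightarrow> 'a) \<Rightarrow> nat \<Rightarrow> 'a" where
  "sCn n s D E F = cdet n (\<lambda>i j. sshift (j - 1) (sT s D E F i j))"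

definition shifted_gens :: "nat \<Rightarrow> (nat \<Rightarrow> nat \<Rightarrow> nat) \<Rightarrow> (nat \<Rightarrow> nat \<Rightarrow> 'a)
      \<Rightarrow> (nat \<Rightarrow> nat \<Rightarrow> nat \<Rightarrow> 'a) \<Rightarrow> (nat \<Rightarrow> nat \<Rightarrow> nat \<Rightarrow> 'a) \<Rightarrow> 'a set" where
  "shifted_gens n s D E F =
     {D i r | i r. i \<in> {1..n} \<and> 0 < r}
   \<union> {E i (Suc i) r | i r. 1 \<le> i \<and> i < n \<and> s i (Suc i) < r}
   \<union> {F i (Suc i) r | i r. 1 \<le> i \<and> i < n \<and> s (Suc i) i < r}"

definition f_algebra :: "('f::field \<Rightarrow> 'a::ring_1) \<Rightarrow> bool" where
  "f_algebra emb \<longleftrightarrow> emb 1 = 1 \<and> (\<forall>x y. emb (x + y) = emb x + emb y)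
     \<and> (\<forall>x y. emb (x * y) = emb x * emb y) \<and> (\<forall>c a. emb c * a = a * emb c)"

inductive_set subalg :: "('f \<Rightarrow> 'a::ring_1) \<Rightarrow> 'a set \<Rightarrow> 'a set" for emb G where
  gen: "x \<in> G \<Longrightarrow> x \<in> subalg emb G"
| scal: "emb c \<in> subalg emb G"
| add: "x \<in> subalg emb G \<Longrightarrow> y \<in> subalg emb G \<Longrightarrow> x + y \<in> subalg emb G"
| neg: "x \<in> subalg emb G \<Longrightarrow> - x \<in> subalg emb G"
| mult: "x \<in> subalg emb G \<Longrightarrow> y \<in> subalg emb G \<Longrightarrow> x * y \<in> subalg emb G"

end

(*
  The determinant does not see the upper unitriangular factor.  By the RTT relation at v = u - 1 the
  column determinant of T_{i, f(b)}(u - b + 1) is alternating in the column labels f, so a column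
  T_j(u - k + 1) standing to the right of T_1(u), ..., T_{k-1}(u - k + 2) with j < k contributes
  zero, whatever coefficients follow on its right.  Both T and sigma-T are F D times an upper
  unitriangular matrix, so column k of sigma-T differs from column k of T by a right combination
  of earlier columns, and the two determinants agree.  The lower factor is unchanged for upper
  triangular sigma, since F_{i,j} = [F_{j-1}^(1), F_{i,j-1}].

  For centrality, the commutator with T_ij^(1), i ~= j, only replaces a row or a column by a
  repeated one.  Clearing row 1 by column operations writes C_n(u) in terms of T_11(u) and the
  quasideterminants T_ij - T_i1 T_11^{-1} T_1j, all of which commute with every T_11^(s).
  The T_ij^(1), i ~= j, and the T_11^(s) generate everything.
*)
theory Submission
  imports Defs "HOL-Computational_Algebra.Formal_Power_Series"
begin

unbundle fps_syntax

section \<open>Series in u^{-1} under u -> u - c, and the expansion of 1/(u - c)\<close>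

section \<open>The shift of the spectral parameter\<close>

text \<open>The type \<open>fps\<close> supplies the ring structure on series; \<open>fps_X\<close>
  stands for u^{-1}.\<close>

definition fsh :: "nat \<Rightarrow> 'a::ring_1 fps \<Rightarrow> 'a fps" where
  "fsh c f = Abs_fps (sshift c (fps_nth f))"

lemma fsh_nth: "fsh c f $ m = sshift c (fps_nth f) m"
  by (simp add: fsh_def)

lemma fsh_add: "fsh c (f + g) = fsh c f + fsh c g"
  by (rule fps_ext) (simp add: fsh_nth sshift_def distrib_right sum.distrib)

lemma fsh_diff: "fsh c (f - g) = fsh c f - fsh c g"
  by (rule fps_ext) (simp add: fsh_nth sshift_def left_diff_distrib sum_subtractf)

lemma fsh_0 [simp]: "fsh c 0 = 0"
  by (rule fps_ext) (simp add: fsh_nth sshift_def)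

lemma fsh_sum: "fsh c (\<Sum>i\<in>I. f i) = (\<Sum>i\<in>I. fsh c (f i))"
  by (induction I rule: infinite_finite_induct) (simp_all add: fsh_add)

lemma fsh_nth_0 [simp]: "fsh c f $ 0 = f $ 0"
  by (simp add: fsh_nth sshift_def)

lemma fsh_nth_Suc:
  "fsh c f $ Suc m = (\<Sum>p\<le>m. f $ Suc p * of_nat (c ^ (m - p) * (m choose (m - p))))"
  unfolding fsh_nth sshift_def sum.atMost_Suc_shift by simp

lemma fsh_const_mult: "fsh c (fps_const a * f) = fps_const a * fsh c f"
  by (rule fps_ext) (simp add: fsh_nth sshift_def sum_distrib_left mult.assoc)

lemma fsh_mult_const: "fsh c (f * fps_const a) = fsh c f * fps_const a"
  by (rule fps_ext)
    (simp only: fsh_nth sshift_def fps_mult_right_const_nth sum_distrib_right mult.assoc mult_of_nat_commute)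

definition geo :: "nat \<Rightarrow> 'a::ring_1 fps" where
  "geo c = Abs_fps (\<lambda>m. of_nat (c ^ m))"

text \<open>The image $1/(u - c)$ of $u^{-1}$ under the shift.\<close>

definition phi :: "nat \<Rightarrow> 'a::ring_1 fps" where
  "phi c = fps_X * geo c"

text \<open>The coefficients are natural multiples of 1, hence central. \<open>phi c\<close>
  inherits this and can be moved freely through noncommuting products.\<close>

lemma geo_commute: "geo c * f = f * geo c"
proof (rule fps_ext)
  fix m
  show "(geo c * f) $ m = (f * geo c) $ m"
    unfolding fps_mult_nth geo_def fps_nth_Abs_fps
    by (rule sum.reindex_bij_witness[where i="\<lambda>i. m - i" and j="\<lambda>i. m - i"])
      (auto simp flip: mult_of_nat_commute simp del: of_nat_power)
qed

lemma phi_commute: "phi c * f = f * phi c"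
  unfolding phi_def by (metis geo_commute fps_mult_fps_X_commute mult.assoc)

lemma phi_nth_0 [simp]: "phi c $ 0 = 0"
  by (simp add: phi_def)

lemma geo_inverse: "geo c * (1 - of_nat c * fps_X) = (1 :: 'a::ring_1 fps)"
proof (rule fps_ext)
  fix m
  have "geo c * (1 - of_nat c * fps_X) = geo c - geo c * fps_const (of_nat c) * (fps_X :: 'a fps)"
    by (simp add: right_diff_distrib mult.assoc fps_of_nat)
  then show "(geo c * (1 - of_nat c * fps_X)) $ m = (1 :: 'a fps) $ m"
    by (cases m) (simp_all add: geo_def power_commutes)
qed

lemma phi_recip: "phi c * (1 - of_nat c * fps_X) = (fps_X :: 'a::ring_1 fps)"
  by (simp add: phi_def mult.assoc geo_inverse)

text \<open>Write f = f_0 + u^{-1} g. The substitution turns u^{-1} into u^{-1}/(1 - c u^{-1});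
  clearing this denominator leaves an identity of coefficients, which is Pascal's rule for the
  binomials in \<open>sshift\<close>.\<close>

lemma fsh_unfold_aux:
  "(1 - of_nat c * fps_X) * (fsh c f - fps_const (f $ 0)) = fps_X * fsh c (fps_shift 1 f)"
  for f :: "'a::ring_1 fps"
proof (rule fps_ext)
  fix m
  define h where "h = fsh c f - fps_const (f $ 0)"
  have h0: "h $ 0 = 0" by (simp add: h_def)
  have hS: "h $ Suc M = (\<Sum>p\<le>M. f $ Suc p * of_nat (c ^ (M - p) * (M choose (M - p))))" for M
    by (simp add: h_def fsh_nth_Suc)
  have "(1 - of_nat c * fps_X) * h = h - fps_const (of_nat c) * (fps_X * h)"
    by (simp add: algebra_simps fps_of_nat)
  also have "\<dots> $ m = (fps_X * fsh c (fps_shift 1 f)) $ m"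
  proof (cases m)
    case 0 then show ?thesis by (simp add: h0)
  next
    case (Suc M)
    show ?thesis
    proof (cases M)
      case 0 then show ?thesis using Suc by (simp add: h0 hS)
    next
      case (Suc N)
      \<comment> \<open>Pascal's rule: the first summand survives, the second cancels against
        \<open>of_nat c * h $ Suc N\<close>.\<close>
      have *: "Suc N choose (Suc N - p) = (N choose (Suc N - p)) + (N choose (N - p))" if "p \<le> N" for p
        using that by (simp add: Suc_diff_le)
      have aux: "of_nat c * (a * of_nat k) = a * (of_nat (c * k) :: 'a)" for a k
        by (metis mult.assoc mult_of_nat_commute of_nat_mult)
      have "of_nat c * h $ Suc N = (\<Sum>p\<le>N. f $ Suc p * of_nat (c ^ (Suc N - p) * (N choose (N - p))))"
        unfolding hS sum_distrib_left aux by (intro sum.cong refl) (simp add: Suc_diff_le mult.assoc)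
      then have "h $ Suc (Suc N) - of_nat c * h $ Suc N
          = f $ Suc (Suc N) + (\<Sum>p\<le>N. f $ Suc p * of_nat (c ^ (Suc N - p) * (Suc N choose (Suc N - p))))
            - (\<Sum>p\<le>N. f $ Suc p * of_nat (c ^ (Suc N - p) * (N choose (N - p))))"
        unfolding hS by (simp only: sum.atMost_Suc diff_self_eq_0 power_0 binomial_n_0 mult_1_right of_nat_1 add.commute)
      also have "\<dots> = f $ Suc (Suc N) + (\<Sum>p\<le>N. f $ Suc p * of_nat (c ^ (Suc N - p) * (N choose (Suc N - p))))"
        unfolding add_diff_eq[symmetric] sum_subtractf[symmetric]
        by (intro arg_cong2[of _ _ _ _ "(+)"] refl sum.cong)
          (simp only: atMost_iff * distrib_left of_nat_add of_nat_mult, simp)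
      also have "\<dots> = (\<Sum>p\<le>Suc N. f $ Suc p * of_nat (c ^ (Suc N - p) * (N choose (Suc N - p))))"
        by simp
      \<comment> \<open>The term \<open>p = 0\<close> vanishes because \<open>N choose Suc N\<close>
        is 0; the others, re-indexed by one, form the coefficient for the tail.\<close>
      also have "\<dots> = fsh c (fps_shift 1 f) $ Suc N"
        unfolding fsh_nth_Suc sum.atMost_Suc_shift by (simp add: binomial_eq_0)
      finally show ?thesis using \<open>m = Suc M\<close> Suc by simp
    qed
  qed
  finally show "((1 - of_nat c * fps_X) * (fsh c f - fps_const (f $ 0))) $ m = (fps_X * fsh c (fps_shift 1 f)) $ m"
    by (simp only: h_def)
qed

lemma fsh_unfold: "fsh c f = fps_const (f $ 0) + phi c * fsh c (fps_shift 1 f)"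
proof -
  have "fsh c f - fps_const (f $ 0) = geo c * ((1 - of_nat c * fps_X) * (fsh c f - fps_const (f $ 0)))"
    by (simp add: geo_inverse flip: mult.assoc)
  also have "\<dots> = phi c * fsh c (fps_shift 1 f)"
    unfolding fsh_unfold_aux by (metis phi_def geo_commute mult.assoc)
  finally show ?thesis by (simp add: algebra_simps)
qed

lemma fsh_X_mult: "fsh c (fps_X * f) = phi c * fsh c f"
proof -
  have "fps_shift 1 (fps_X * f) = f"
    by (rule fps_ext) simp
  then show ?thesis
    by (subst fsh_unfold) (simp only: fps_X_mult_nth if_True fps_const_0_eq_0 add_0_left simp_thms)
qed

text \<open>Only coefficients of \<open>f\<close> of index strictly below \<open>m\<close> occur;
  this is what drives the inductions on \<open>m\<close>.\<close>

lemma phi_mult_nth: "(phi c * f) $ m = (\<Sum>p<m. of_nat (c ^ (m - Suc p)) * f $ p)"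
proof (cases m)
  case (Suc M)
  have "(phi c * f) $ m = (geo c * f) $ M"
    by (simp add: phi_def mult.assoc Suc)
  also have "\<dots> = (\<Sum>p\<le>M. of_nat (c ^ (M - p)) * f $ p)"
    unfolding fps_mult_nth geo_def fps_nth_Abs_fps
    by (rule sum.reindex_bij_witness[where i="\<lambda>i. M - i" and j="\<lambda>i. M - i"]) auto
  finally show ?thesis by (simp add: Suc lessThan_Suc_atMost)
qed simp

lemma fps_split: "f = fps_const (f $ 0) + fps_X * fps_shift 1 (f :: 'a::ring_1 fps)"
  by (rule fps_ext) (simp add: fps_X_mult_nth)

text \<open>Induction on the coefficient index, for all \<open>f\<close> at once: split off the
  constant term of \<open>f\<close>. The remaining part carries a factor \<open>phi c\<close>, so
  its coefficient at \<open>m\<close> involves only smaller indices.\<close>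

lemma fsh_mult: "fsh c (f * g) = fsh c f * fsh c g"
proof (rule fps_ext)
  fix m
  show "fsh c (f * g) $ m = (fsh c f * fsh c g) $ m"
  proof (induction m arbitrary: f rule: less_induct)
    case (less m)
    let ?f = "fps_shift 1 f"
    have "fsh c (f * g) = fsh c (fps_const (f $ 0) * g + fps_X * (?f * g))"
      by (subst fps_split[of f]) (simp add: distrib_right mult.assoc)
    also have "\<dots> = fps_const (f $ 0) * fsh c g + phi c * fsh c (?f * g)"
      by (simp add: fsh_add fsh_const_mult fsh_X_mult)
    finally have "fsh c (f * g) $ m = (fps_const (f $ 0) * fsh c g + phi c * (fsh c ?f * fsh c g)) $ m"
      using less.IH by (simp add: phi_mult_nth)
    also have "\<dots> = (fsh c f * fsh c g) $ m"
      by (subst fsh_unfold[of c f]) (simp add: distrib_right mult.assoc)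
    finally show ?case .
  qed
qed

text \<open>Each \<open>Z p\<close> is divisible by every power of \<open>phi c\<close>, a series
  without constant term.\<close>

lemma phi_divisible_zero:
  assumes "\<And>p. Z p = phi c * Z (Suc p)"
  shows "Z p = 0"
proof (rule fps_ext)
  fix m show "Z p $ m = (0::'a::ring_1 fps) $ m"
  proof (induction m arbitrary: p rule: less_induct)
    case (less m)
    show ?case by (subst assms) (simp add: phi_mult_nth less.IH)
  qed
qed

text \<open>Multiplication by \<open>fps_X\<close> only moves coefficients, so it is injective even
  when the coefficient ring has zero divisors.\<close>

lemma fps_X_cancel:
  assumes "f * fps_X = g * (fps_X :: 'a::ring_1 fps)"
  shows "f = g"
proof (rule fps_ext)
  fix m
  have "(f * fps_X) $ Suc m = (g * fps_X) $ Suc m"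
    by (simp only: assms)
  then show "f $ m = g $ m"
    by simp
qed

text \<open>This is 1/(u - b) - 1/(u - a) = (b - a)/((u - a)(u - b)); it produces the factor u - v
  of the RTT relation.\<close>

lemma phi_diff: "phi b - phi a = (of_nat b - of_nat a) * (phi a * phi b :: 'a::ring_1 fps)"
proof (rule fps_X_cancel)
  let ?a = "phi a :: 'a fps" and ?b = "phi b :: 'a fps"
  have "(?b - ?a) * fps_X = ?b * (?a * (1 - of_nat a * fps_X)) - ?a * (?b * (1 - of_nat b * fps_X))"
    by (simp only: phi_recip left_diff_distrib)
  also have "\<dots> = ?a * ?b * ((of_nat b - of_nat a) * fps_X)"
    unfolding mult.assoc[symmetric] phi_commute[of b ?a]
    by (simp add: right_diff_distrib left_diff_distrib mult.assoc)
  also have "\<dots> = (of_nat b - of_nat a) * (?a * ?b) * fps_X"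
    by (simp add: left_diff_distrib right_diff_distrib mult_of_nat_commute mult.assoc)
  finally show "(?b - ?a) * fps_X = (of_nat b - of_nat a) * (?a * ?b) * fps_X" .
qed

lemma phi_cancel:
  assumes "phi c * f = phi c * g"
  shows "f = g"
proof (rule fps_X_cancel)
  have *: "h * fps_X = phi c * h * (1 - of_nat c * fps_X)" for h :: "'a fps"
    by (simp only: phi_commute[of c h] mult.assoc phi_recip)
  show "f * fps_X = g * fps_X"
    by (subst (1 2) *) (simp only: assms)
qed

section \<open>Signed sums over the symmetric group with noncommuting values\<close>

section \<open>Alternating sums over permutations\<close>

definition alt :: "nat \<Rightarrow> ((nat \<Rightarrow> nat) \<Rightarrow> 'r::ring_1) \<Rightarrow> 'r" where
  "alt n g = (\<Sum>w\<in>{w. w permutes {1..n}}. of_int (sign w) * g w)"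

lemma alt_cong: "(\<And>w. w permutes {1..n} \<Longrightarrow> g w = h w) \<Longrightarrow> alt n g = alt n h"
  by (simp add: alt_def)

lemma alt_add: "alt n (\<lambda>w. g w + h w) = alt n g + alt n h"
  by (simp add: alt_def distrib_left sum.distrib)

lemma alt_diff: "alt n (\<lambda>w. g w - h w) = alt n g - alt n h"
  by (simp add: alt_def right_diff_distrib sum_subtractf)

lemma alt_zero [simp]: "alt n (\<lambda>w. 0) = 0"
  by (simp add: alt_def)

lemma alt_sum: "alt n (\<lambda>w. \<Sum>i\<in>I. g i w) = (\<Sum>i\<in>I. alt n (g i))"
  by (induction I rule: infinite_finite_induct) (simp_all add: alt_add)

text \<open>Right multiplication by the transposition is a fixed-point-free involution exchanging w
  a < w b with w b < w a. Summing over one half of the group avoids a division by 2.\<close>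

lemma sum_permutes_pair:
  fixes g h :: "(nat \<Rightarrow> nat) \<Rightarrow> 'b::comm_monoid_add"
  assumes S: "finite S" "a \<in> S" "b \<in> S" "a \<noteq> b"
    and pair: "\<And>w. w permutes S \<Longrightarrow> g w + g (w \<circ> transpose a b) = h w + h (w \<circ> transpose a b)"
  shows "sum g {w. w permutes S} = sum h {w. w permutes S}"
proof -
  let ?t = "transpose a b"
  let ?A = "{w. w permutes S \<and> w a < w b}" and ?B = "{w. w permutes S \<and> w b < w a}"
  have ne: "w a \<noteq> w b" if "w permutes S" for w
    using permutes_inj[OF that] S(4) by (auto dest: injD)
  have un: "{w. w permutes S} = ?A \<union> ?B"
    using ne by (auto simp: neq_iff)
  have fin: "finite ?A" "finite ?B"
    by (rule finite_subset[OF _ finite_permutations[OF S(1)]]; auto)+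
  have t: "?t permutes S" using S by (simp add: permutes_swap_id)
  have tt: "(w \<circ> ?t) \<circ> ?t = w" for w :: "nat \<Rightarrow> nat"
    by (rule ext) simp
  have eq: "sum k {w. w permutes S} = (\<Sum>w\<in>?A. k w + k (w \<circ> ?t))" for k :: "_ \<Rightarrow> 'b"
  proof -
    have "sum k ?B = (\<Sum>w\<in>?A. k (w \<circ> ?t))"
      by (rule sum.reindex_bij_witness[where i="\<lambda>w. w \<circ> ?t" and j="\<lambda>w. w \<circ> ?t"])
        (auto simp: tt permutes_compose[OF t])
    moreover have "sum k {w. w permutes S} = sum k ?A + sum k ?B"
      unfolding un by (rule sum.union_disjoint) (use fin in auto)
    ultimately show ?thesis by (simp add: sum.distrib)
  qed
  show ?thesis
    unfolding eq by (rule sum.cong) (use pair in auto)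
qed

lemma sign_comp_transpose:
  assumes "w permutes S" "finite S" "a \<noteq> b"
  shows "sign (w \<circ> transpose a b) = - sign w"
proof -
  have "permutation w" using assms by (auto simp: permutation_permutes)
  then show ?thesis
    using assms by (simp add: sign_compose permutation_swap_id sign_swap_id)
qed

lemma alt_pair:
  assumes "a \<in> {1..n}" "b \<in> {1..n}" "a \<noteq> b"
    and "\<And>w. w permutes {1..n} \<Longrightarrow> g w - g (w \<circ> transpose a b) = h w - h (w \<circ> transpose a b)"
  shows "alt n g = alt n h"
  unfolding alt_def
proof (rule sum_permutes_pair[of _ a b])
  fix w assume w: "w permutes {1..n}"
  have "of_int (sign w) * k w + of_int (sign (w \<circ> transpose a b)) * k (w \<circ> transpose a b)
      = of_int (sign w) * (k w - k (w \<circ> transpose a b))" for k :: "_ \<Rightarrow> 'a"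
    using sign_comp_transpose[OF w _ assms(3)] by (simp add: right_diff_distrib)
  then show "of_int (sign w) * g w + of_int (sign (w \<circ> transpose a b)) * g (w \<circ> transpose a b)
      = of_int (sign w) * h w + of_int (sign (w \<circ> transpose a b)) * h (w \<circ> transpose a b)"
    using assms(4)[OF w] by simp
qed (use assms in auto)

lemma alt_inverse: "alt n (\<lambda>w. g (inv w)) = alt n g"
proof -
  have "sign (inv w) = sign w" if "w permutes {1..n}" for w
    using that by (intro sign_inverse) (auto simp: permutation_permutes)
  then show ?thesis
    unfolding alt_def by (subst (2) sum_permutations_inverse) simp
qed

text \<open>Composing on the left exchanges rows. Passing to inverses, which have the same sign,
  turns this into an exchange of positions.\<close>

lemma alt_row_vanish:
  assumes "a \<in> {1..n}" "b \<in> {1..n}" "a \<noteq> b"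
    and "\<And>w. w permutes {1..n} \<Longrightarrow> g (transpose a b \<circ> w) = g w"
  shows "alt n g = 0"
proof -
  have "alt n (\<lambda>w. g (inv w)) = alt n (\<lambda>w. 0)"
  proof (rule alt_pair[OF assms(1-3)])
    fix w assume w: "w permutes {1..n}"
    have "inv (w \<circ> transpose a b) = transpose a b \<circ> inv w"
      using o_inv_distrib[OF permutes_bij[OF w] bij_transpose] by simp
    then show "g (inv w) - g (inv (w \<circ> transpose a b)) = 0 - 0"
      using assms(4)[OF permutes_inv[OF w]] by simp
  qed
  then show ?thesis by (simp add: alt_inverse)
qed

lemma prod_list_split_adjacent:
  assumes "1 \<le> c" "c < k"
  shows "prod_list (map g [1..<Suc k]) =
    prod_list (map g [1..<c]) * (g c * g (Suc c)) * prod_list (map g [Suc (Suc c)..<Suc k])"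
proof -
  have "[1..<Suc k] = [1..<c] @ [c..<Suc k]"
    using upt_add_eq_append[of 1 c "Suc k - c"] assms by simp
  also have "[c..<Suc k] = c # Suc c # [Suc (Suc c)..<Suc k]"
    using assms by (simp add: upt_conv_Cons del: upt_Suc)
  finally show ?thesis by (simp add: mult.assoc del: upt_Suc)
qed

section \<open>The RTT relation at shifted parameters and antisymmetry in the columns\<close>

section \<open>The RTT relations and alternating columns\<close>

text \<open>The elements may lie in any ring where the relations hold, so the results apply to every
  image of the Yangian.\<close>

locale yangian =
  fixes n :: nat and t :: "nat \<Rightarrow> nat \<Rightarrow> nat \<Rightarrow> 'a::ring_1"
  assumes rel: "yangian_rel n t"
begin

definition TT :: "nat \<Rightarrow> nat \<Rightarrow> 'a fps" where
  "TT i j = Abs_fps (Tc t i j)"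

lemma TT_nth: "TT i j $ r = Tc t i j r"
  by (simp add: TT_def)

lemma TT_nth_0: "TT i j $ 0 = (if i = j then 1 else 0)"
  by (simp add: TT_def Tc_def)

lemma Tc_commutator:
  assumes "i \<in> {1..n}" "j \<in> {1..n}" "k \<in> {1..n}" "l \<in> {1..n}"
  shows "Tc t i j r * Tc t k l s - Tc t k l s * Tc t i j r =
        (\<Sum>q<min r s. Tc t k j q * Tc t i l (r + s - 1 - q) - Tc t k j (r + s - 1 - q) * Tc t i l q)"
proof (cases "1 \<le> r \<and> 1 \<le> s")
  case True then show ?thesis using rel assms unfolding yangian_rel_def by blast
next
  case False
  then have "r = 0 \<or> s = 0" by auto
  then show ?thesis by (auto simp: Tc_def)
qed

text \<open>Coefficient of u^{-r} v^{-s} in (u - v)[T_ij(u), T_kl(v)] = T_kj(u) T_il(v) - T_kj(v)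
  T_il(u). Both commutators are sums of the same terms \<open>G q\<close>, since r + s agrees, and
  their ranges differ in at most one term.\<close>

lemma Tc_commutator_step:
  assumes "i \<in> {1..n}" "j \<in> {1..n}" "k \<in> {1..n}" "l \<in> {1..n}"
  shows "Tc t i j (Suc r) * Tc t k l s - Tc t k l s * Tc t i j (Suc r) =
    Tc t i j r * Tc t k l (Suc s) - Tc t k l (Suc s) * Tc t i j r
    + (Tc t k j r * Tc t i l s - Tc t k j s * Tc t i l r)"
proof -
  define G where "G q = Tc t k j q * Tc t i l (r + s - q) - Tc t k j (r + s - q) * Tc t i l q" for q
  have 1: "Tc t i j (Suc r) * Tc t k l s - Tc t k l s * Tc t i j (Suc r) = (\<Sum>q<min (Suc r) s. G q)"
    unfolding Tc_commutator[OF assms] G_def by simp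
  have 2: "Tc t i j r * Tc t k l (Suc s) - Tc t k l (Suc s) * Tc t i j r = (\<Sum>q<min r (Suc s). G q)"
    unfolding Tc_commutator[OF assms] G_def by simp
  consider "r < s" | "r = s" | "s < r" by linarith
  then show ?thesis
  proof cases
    case 1
    then have "min (Suc r) s = Suc r" "min r (Suc s) = r" by auto
    then show ?thesis unfolding \<open>_ = (\<Sum>q<min (Suc r) s. G q)\<close> 2 by (simp add: G_def)
  next
    case 2
    then show ?thesis unfolding 1 \<open>_ = (\<Sum>q<min r (Suc s). G q)\<close> by simp
  next
    case 3
    then have "min (Suc r) s = s" "min r (Suc s) = Suc s" by auto
    then show ?thesis unfolding 1 2 by (simp add: G_def)
  qed
qed

lemma series_commutator_step:
  assumes "i \<in> {1..n}" "j \<in> {1..n}" "k \<in> {1..n}" "l \<in> {1..n}"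
  defines "C \<equiv> \<lambda>i j r. fps_const (Tc t i j r)"
  shows "fps_X * (C i j (Suc r) * TT k l - TT k l * C i j (Suc r)) =
    C i j r * TT k l - TT k l * C i j r + fps_X * (C k j r * TT i l - TT k j * C i l r)"
proof (rule fps_ext)
  fix m
  show "(fps_X * (C i j (Suc r) * TT k l - TT k l * C i j (Suc r))) $ m =
    (C i j r * TT k l - TT k l * C i j r + fps_X * (C k j r * TT i l - TT k j * C i l r)) $ m"
  proof (cases m)
    case 0
    then show ?thesis by (simp add: C_def TT_nth_0)
  next
    case (Suc s)
    then show ?thesis using Tc_commutator_step[OF assms(1-4), of r s]
      by (simp add: C_def TT_nth)
  qed
qed

text \<open>The RTT relation with both parameters specialised to shifts of one variable, so that u -
  v becomes b - a. In effect the recursion \<open>series_commutator_step\<close> is summed over r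
  with weights the powers of \<open>phi a\<close>; the tails \<open>tl\<close> organise this
  infinite sum.\<close>

lemma shifted_commutator:
  assumes "i \<in> {1..n}" "j \<in> {1..n}" "k \<in> {1..n}" "l \<in> {1..n}"
  shows "(of_nat b - of_nat a) * (fsh a (TT i j) * fsh b (TT k l) - fsh b (TT k l) * fsh a (TT i j)) =
    fsh a (TT k j) * fsh b (TT i l) - fsh b (TT k j) * fsh a (TT i l)"
proof -
  define tl where "tl i j p = fsh a (fps_shift p (TT i j))" for i j p
  define K where "K = fsh b (TT k l)"
  define L where "L = fsh b (TT i l)"
  define M where "M = fsh b (TT k j)"
  define br where "br x = x * K - K * x" for x
  define W where "W p = tl k j p * L - M * tl i l p" for p
  define c where "c i j p = fps_const (Tc t i j p)" for i j p
  have tl_unfold: "tl i j p = c i j p + phi a * tl i j (Suc p)" for i j p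
    unfolding tl_def c_def by (subst fsh_unfold) (simp add: TT_nth fps_shift_fps_shift[of 1, simplified, symmetric])
  have br_add: "br (x + y) = br x + br y" for x y
    by (simp add: br_def algebra_simps)
  have br_phi: "br (phi a * x) = phi a * br x" for x
    unfolding br_def right_diff_distrib by (metis phi_commute mult.assoc)
  have br_tl: "br (tl i j p) = br (c i j p) + phi a * br (tl i j (Suc p))" for p
    by (subst tl_unfold) (simp only: br_add br_phi)
  have W_unfold: "W p = (c k j p * L - M * c i l p) + phi a * W (Suc p)" for p
  proof -
    have "M * (phi a * x) = phi a * (M * x)" for x
      by (metis phi_commute mult.assoc)
    then show ?thesis
      unfolding W_def by (subst (1 2) tl_unfold) (simp add: algebra_simps)
  qed
  have step: "phi b * br (c i j (Suc p)) = br (c i j p) + phi b * (c k j p * L - M * c i l p)" for p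
    using arg_cong[OF series_commutator_step[OF assms, of p], of "fsh b"]
    by (simp only: fsh_X_mult fsh_add fsh_diff fsh_const_mult fsh_mult_const br_def c_def K_def L_def M_def)
  \<comment> \<open>The defect of the claim for the tails is divisible by every power of \<open>phi a\<close>.\<close>
  define Z where "Z p = phi b * br (tl i j (Suc p)) - br (tl i j p) - phi b * W p" for p
  have "Z p = phi a * Z (Suc p)" for p
  proof -
    have ba: "phi b * (phi a * x) = phi a * (phi b * x)" for x :: "'a fps"
      by (metis phi_commute mult.assoc)
    have "Z p = phi b * br (c i j (Suc p)) + phi b * (phi a * br (tl i j (Suc (Suc p))))
       - (br (c i j p) + phi a * br (tl i j (Suc p)))
       - phi b * ((c k j p * L - M * c i l p) + phi a * W (Suc p))"
      unfolding Z_def by (simp only: br_tl[of p] br_tl[of "Suc p"] W_unfold[of p] distrib_left)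
    also have "\<dots> = phi a * Z (Suc p)"
      unfolding step Z_def by (simp add: algebra_simps ba)
    finally show ?thesis .
  qed
  then have "Z 0 = 0" by (rule phi_divisible_zero)
  then have Z0: "phi b * br (tl i j (Suc 0)) = br (tl i j 0) + phi b * W 0"
    by (simp add: Z_def algebra_simps)
  \<comment> \<open>T_ij^(0) is 0 or 1, so the bracket of the full series is \<open>phi a\<close>
    times that of its first tail. This allows the tail to be eliminated from
    \<open>Z0\<close>.\<close>
  have "br (c i j 0) = 0"
    by (auto simp: br_def c_def Tc_def)
  then have "br (tl i j 0) = phi a * br (tl i j (Suc 0))"
    by (subst br_tl) simp
  then have "phi b * br (tl i j 0) = phi a * (phi b * br (tl i j (Suc 0)))"
    by (metis phi_commute mult.assoc)
  also have "\<dots> = phi a * br (tl i j 0) + phi a * (phi b * W 0)"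
    by (simp only: Z0 distrib_left)
  finally have "(phi b - phi a) * br (tl i j 0) = phi a * (phi b * W 0)"
    by (simp add: left_diff_distrib)
  \<comment> \<open>\<open>phi_diff\<close> brings in b - a; then \<open>phi a\<close> and
    \<open>phi b\<close> can be cancelled.\<close>
  moreover have "(phi b - phi a) * br (tl i j 0) = phi a * (phi b * ((of_nat b - of_nat a) * br (tl i j 0)))"
  proof -
    have "x * (of_nat b - of_nat a) = (of_nat b - of_nat a) * x" for x :: "'a fps"
      by (simp add: left_diff_distrib right_diff_distrib mult_of_nat_commute)
    then show ?thesis unfolding phi_diff by (metis mult.assoc)
  qed
  ultimately have "(of_nat b - of_nat a) * br (tl i j 0) = W 0"
    by (metis phi_cancel)
  then show ?thesis
    by (simp add: br_def W_def tl_def K_def L_def M_def)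
qed

text \<open>For shifts differing by one the factor b - a is 1, and the products in the wrong order
  on the two sides coincide.\<close>

lemma adjacent_same_column:
  assumes "i \<in> {1..n}" "j \<in> {1..n}" "k \<in> {1..n}"
  shows "fsh a (TT i j) * fsh (Suc a) (TT k j) = fsh a (TT k j) * fsh (Suc a) (TT i j)"
  using shifted_commutator[OF assms(1-3,2), of "Suc a" a] by simp

text \<open>The relation shows that T_ij(u-a) T_kl(u-a-1), symmetrised in the columns j and l, is
  symmetric in the rows i and k. Hence antisymmetrising the rows antisymmetrises the
  columns.\<close>

lemma adjacent_swap_columns:
  assumes "i \<in> {1..n}" "j \<in> {1..n}" "k \<in> {1..n}" "l \<in> {1..n}"
  shows "fsh a (TT i j) * fsh (Suc a) (TT k l) - fsh a (TT k j) * fsh (Suc a) (TT i l)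
     = - (fsh a (TT i l) * fsh (Suc a) (TT k j) - fsh a (TT k l) * fsh (Suc a) (TT i j))"
proof -
  have *: "- (fsh (Suc a) (TT k l) * fsh a (TT i j) - fsh a (TT i j) * fsh (Suc a) (TT k l))
     = fsh (Suc a) (TT i l) * fsh a (TT k j) - fsh a (TT i l) * fsh (Suc a) (TT k j)"
    if "i \<in> {1..n}" "k \<in> {1..n}" for i k
    using shifted_commutator[OF that(2) assms(4) that(1) assms(2), of a "Suc a"] by simp
  show ?thesis
    using *[OF assms(1,3)] *[OF assms(3,1)] by (simp add: algebra_simps)
qed

text \<open>The column label \<open>f b\<close> is decoupled from the shift \<open>b - 1\<close>,
  which stays attached to the position.\<close>

definition colprod :: "(nat \<Rightarrow> nat) \<Rightarrow> nat \<Rightarrow> (nat \<Rightarrow> nat) \<Rightarrow> 'a fps" where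
  "colprod f k w = prod_list (map (\<lambda>b. fsh (b - 1) (TT (w b) (f b))) [1..<Suc k])"

text \<open>\<open>R\<close> stands for whatever follows the first \<open>k\<close> factors: it must
  not notice a rearrangement of the values of \<open>w\<close> at positions up to
  \<open>k\<close>.\<close>

definition swap_invariant :: "nat \<Rightarrow> ((nat \<Rightarrow> nat) \<Rightarrow> 'a fps) \<Rightarrow> bool" where
  "swap_invariant k R \<longleftrightarrow>
    (\<forall>w c. w permutes {1..n} \<longrightarrow> 1 \<le> c \<longrightarrow> c < k \<longrightarrow> R (w \<circ> transpose c (Suc c)) = R w)"

text \<open>One pair \<open>A\<close>, \<open>B\<close> serves all labels and permutations that
  differ only at two adjacent positions, so the resulting products can be compared.\<close>

lemma colprod_adjacent:
  assumes c: "1 \<le> c" "c < k"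
  obtains A B where
    "\<And>f' w'. (\<And>b. b \<noteq> c \<Longrightarrow> b \<noteq> Suc c \<Longrightarrow> f' b = f b) \<Longrightarrow> (\<And>b. b \<noteq> c \<Longrightarrow> b \<noteq> Suc c \<Longrightarrow> w' b = w b)
      \<Longrightarrow> colprod f' k w' = A * (fsh (c - 1) (TT (w' c) (f' c)) * fsh c (TT (w' (Suc c)) (f' (Suc c)))) * B"
proof -
  let ?g = "\<lambda>b. fsh (b - 1) (TT (w b) (f b))"
  show thesis
  proof (rule that[of "prod_list (map ?g [1..<c])" "prod_list (map ?g [Suc (Suc c)..<Suc k])"])
    fix f' w' assume f': "\<And>b. b \<noteq> c \<Longrightarrow> b \<noteq> Suc c \<Longrightarrow> f' b = f b"
      and w': "\<And>b. b \<noteq> c \<Longrightarrow> b \<noteq> Suc c \<Longrightarrow> w' b = w b"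
    have 1: "map (\<lambda>b. fsh (b - 1) (TT (w' b) (f' b))) [1..<c] = map ?g [1..<c]"
      by (rule map_cong) (auto simp: f' w')
    have 2: "map (\<lambda>b. fsh (b - 1) (TT (w' b) (f' b))) [Suc (Suc c)..<Suc k] = map ?g [Suc (Suc c)..<Suc k]"
      by (rule map_cong) (auto simp: f' w' simp del: upt_Suc)
    show "colprod f' k w' = prod_list (map ?g [1..<c]) * (fsh (c - 1) (TT (w' c) (f' c)) *
        fsh c (TT (w' (Suc c)) (f' (Suc c)))) * prod_list (map ?g [Suc (Suc c)..<Suc k])"
      unfolding colprod_def prod_list_split_adjacent[OF c] 1 2 by simp
  qed
qed

lemma permutes_range: "w permutes {1..n} \<Longrightarrow> i \<in> {1..n} \<Longrightarrow> w i \<in> {1..n}"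
  using permutes_in_image by metis

text \<open>Pairing \<open>w\<close> with its composite with the transposition antisymmetrises the
  rows of two adjacent factors; \<open>adjacent_swap_columns\<close> then applies, the outer factors
  being unchanged.\<close>

lemma alt_swap_columns:
  assumes f: "f ` {1..k} \<subseteq> {1..n}" and k: "k \<le> n" and c: "1 \<le> c" "c < k"
    and R: "swap_invariant k R"
  shows "alt n (\<lambda>w. colprod f k w * R w) = - alt n (\<lambda>w. colprod (f \<circ> transpose c (Suc c)) k w * R w)"
proof -
  let ?t = "transpose c (Suc c)"
  have "alt n (\<lambda>w. colprod f k w * R w) = alt n (\<lambda>w. - (colprod (f \<circ> ?t) k w * R w))"
  proof (rule alt_pair[of c _ "Suc c"])
    fix w assume w: "w permutes {1..n}"
    obtain A B where AB: "\<And>f' w'. (\<And>b. b \<noteq> c \<Longrightarrow> b \<noteq> Suc c \<Longrightarrow> f' b = f b) \<Longrightarrow> (\<And>b. b \<noteq> c \<Longrightarrow> b \<noteq> Suc c \<Longrightarrow> w' b = w b)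
      \<Longrightarrow> colprod f' k w' = A * (fsh (c - 1) (TT (w' c) (f' c)) * fsh c (TT (w' (Suc c)) (f' (Suc c)))) * B"
      using colprod_adjacent[OF c, of f w] by blast
    have mem: "w c \<in> {1..n}" "w (Suc c) \<in> {1..n}" "f c \<in> {1..n}" "f (Suc c) \<in> {1..n}"
      using c k f permutes_range[OF w] by (auto simp: image_subset_iff)
    have e: "colprod f k w = A * (fsh (c - 1) (TT (w c) (f c)) * fsh c (TT (w (Suc c)) (f (Suc c)))) * B"
       "colprod f k (w \<circ> ?t) = A * (fsh (c - 1) (TT (w (Suc c)) (f c)) * fsh c (TT (w c) (f (Suc c)))) * B"
       "colprod (f \<circ> ?t) k w = A * (fsh (c - 1) (TT (w c) (f (Suc c))) * fsh c (TT (w (Suc c)) (f c))) * B"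
       "colprod (f \<circ> ?t) k (w \<circ> ?t) = A * (fsh (c - 1) (TT (w (Suc c)) (f (Suc c))) * fsh c (TT (w c) (f c))) * B"
      by (subst AB; simp)+
    have Rw: "R (w \<circ> ?t) = R w" using R w c by (simp add: swap_invariant_def)
    have c1: "0 < c" using c by simp
    note key = adjacent_swap_columns[OF mem(1,3,2,4), of "c - 1", unfolded Suc_diff_1[OF c1]]
    have "colprod f k w * R w - colprod f k (w \<circ> ?t) * R (w \<circ> ?t) =
       A * (fsh (c - 1) (TT (w c) (f c)) * fsh c (TT (w (Suc c)) (f (Suc c)))
         - fsh (c - 1) (TT (w (Suc c)) (f c)) * fsh c (TT (w c) (f (Suc c)))) * B * R w"
      unfolding e Rw by (simp add: algebra_simps)
    also have "\<dots> = - (colprod (f \<circ> ?t) k w * R w) - - (colprod (f \<circ> ?t) k (w \<circ> ?t) * R (w \<circ> ?t))"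
      unfolding e Rw key by (simp add: algebra_simps)
    finally show "colprod f k w * R w - colprod f k (w \<circ> ?t) * R (w \<circ> ?t) =
      - (colprod (f \<circ> ?t) k w * R w) - - (colprod (f \<circ> ?t) k (w \<circ> ?t) * R (w \<circ> ?t))" .
  qed (use c k in auto)
  also have "\<dots> = - alt n (\<lambda>w. colprod (f \<circ> ?t) k w * R w)"
    using alt_diff[of n "\<lambda>w. 0" "\<lambda>w. colprod (f \<circ> ?t) k w * R w"] by simp
  finally show ?thesis .
qed

text \<open>Induction on the distance of the equal labels. Adjacent ones give a product symmetric in
  the rows, which cancels in pairs without any division by 2.\<close>

lemma alt_repeated_column:
  assumes "f ` {1..k} \<subseteq> {1..n}" and k: "k \<le> n" and "1 \<le> a" "a < b" "b \<le> k" "f a = f b"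
    and R: "swap_invariant k R"
  shows "alt n (\<lambda>w. colprod f k w * R w) = 0"
  using assms(1,3-6)
proof (induction "b - Suc a" arbitrary: f b)
  case 0
  then have b: "b = Suc a" by simp
  have "alt n (\<lambda>w. colprod f k w * R w) = alt n (\<lambda>w. 0)"
  proof (rule alt_pair[of a _ "Suc a"])
    fix w assume w: "w permutes {1..n}"
    have c: "1 \<le> a" "a < k" using 0 b by auto
    obtain A B where AB: "\<And>f' w'. (\<And>b. b \<noteq> a \<Longrightarrow> b \<noteq> Suc a \<Longrightarrow> f' b = f b) \<Longrightarrow> (\<And>b. b \<noteq> a \<Longrightarrow> b \<noteq> Suc a \<Longrightarrow> w' b = w b)
      \<Longrightarrow> colprod f' k w' = A * (fsh (a - 1) (TT (w' a) (f' a)) * fsh a (TT (w' (Suc a)) (f' (Suc a)))) * B"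
      using colprod_adjacent[OF c, of f w] by blast
    have mem: "w a \<in> {1..n}" "w (Suc a) \<in> {1..n}" "f a \<in> {1..n}"
      using c k 0(2) permutes_range[OF w] by (auto simp: image_subset_iff)
    let ?t = "transpose a (Suc a)"
    have ff: "f (Suc a) = f a" using 0(6) b by simp
    have e: "colprod f k w = A * (fsh (a - 1) (TT (w a) (f a)) * fsh a (TT (w (Suc a)) (f a))) * B"
       "colprod f k (w \<circ> ?t) = A * (fsh (a - 1) (TT (w (Suc a)) (f a)) * fsh a (TT (w a) (f a))) * B"
      by (subst AB; simp add: ff)+
    have Rw: "R (w \<circ> ?t) = R w" using R w c by (simp add: swap_invariant_def)
    show "colprod f k w * R w - colprod f k (w \<circ> ?t) * R (w \<circ> ?t) = 0 - 0"
      using adjacent_same_column[OF mem(1,3,2), of "a - 1"] c unfolding e Rw by simp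
  qed (use 0 b k in auto)
  then show ?case by simp
next
  case (Suc d)
  \<comment> \<open>The right one of the equal labels moves one position to the left, at the cost of
    a sign.\<close>
  define c where "c = b - 1"
  have c: "1 \<le> c" "c < k" "Suc c = b" "a < c" "d = c - Suc a" using Suc by (auto simp: c_def)
  let ?f = "f \<circ> transpose c (Suc c)"
  have "transpose c (Suc c) ` {1..k} \<subseteq> {1..k}"
    using c by (auto simp: transpose_def)
  then have "?f ` {1..k} \<subseteq> {1..n}" using Suc.prems(1) by fastforce
  moreover have "?f a = ?f c" using c Suc.prems(5) by simp
  ultimately have "alt n (\<lambda>w. colprod ?f k w * R w) = 0"
    using Suc.hyps(1)[of c ?f] c Suc.prems by simp
  then show ?case
    using alt_swap_columns[OF Suc.prems(1) k c(1,2) R] by simp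
qed

end

section \<open>Multilinearity and the Leibniz rule for ordered products\<close>

section \<open>Products along the columns\<close>

lemma fps_X_left_commute: "z * (fps_X * z') = fps_X * (z * (z' :: 'a::ring_1 fps))"
  using fps_mult_fps_X_commute[of z] by (simp flip: mult.assoc)

lemma fps_X_cancel_left: "fps_X * f = fps_X * g \<Longrightarrow> f = (g :: 'a::ring_1 fps)"
  by (rule fps_X_cancel) (simp flip: fps_mult_fps_X_commute)

lemma prod_list_upt_Suc:
  "prod_list (map g [1..<Suc (Suc m)]) = prod_list (map g [1..<Suc m]) * (g (Suc m) :: 'r::monoid_mult)"
  by simp

lemma prod_list_upt_cong:
  "(\<And>b. b \<in> {1..m} \<Longrightarrow> g b = h b) \<Longrightarrow>
    prod_list (map g [1..<Suc m]) = prod_list (map h [1..<Suc m])"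
  by (rule arg_cong[of _ _ prod_list], rule map_cong) auto

lemma prod_list_upt_diff:
  fixes g :: "nat \<Rightarrow> 'r::ring_1"
  assumes "1 \<le> b" "b \<le> m"
  shows "prod_list (map (g(b := u - v)) [1..<Suc m]) =
    prod_list (map (g(b := u)) [1..<Suc m]) - prod_list (map (g(b := v)) [1..<Suc m])"
  using assms
proof (induction m)
  case (Suc m)
  show ?case
  proof (cases "b = Suc m")
    case True
    have "prod_list (map (g(b := x)) [1..<Suc m]) = prod_list (map g [1..<Suc m])" for x
      by (rule prod_list_upt_cong) (auto simp: True)
    then show ?thesis unfolding prod_list_upt_Suc by (simp only: True fun_upd_same right_diff_distrib)
  next
    case False
    have "(g(b := x)) (Suc m) = g (Suc m)" for x
      using False by simp
    moreover have "b \<le> m" using False Suc.prems by simp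
    ultimately show ?thesis
      unfolding prod_list_upt_Suc using Suc.IH[OF Suc.prems(1)] by (simp only: left_diff_distrib)
  qed
qed simp

lemma prod_list_upt_zero:
  assumes "1 \<le> b" "b \<le> m" "g b = (0 :: 'r::ring_1)"
  shows "prod_list (map g [1..<Suc m]) = 0"
  using prod_list_upt_diff[OF assms(1,2), of g 0 0] assms(3) by (simp add: fun_upd_idem)

text \<open>The bracket with \<open>x\<close> is a derivation.\<close>

lemma commutator_prod_list:
  fixes x :: "'r::ring_1"
  shows "x * prod_list (map g [1..<Suc m]) - prod_list (map g [1..<Suc m]) * x =
    (\<Sum>b=1..m. prod_list (map (g(b := x * g b - g b * x)) [1..<Suc m]))"
proof (induction m)
  case (Suc m)
  let ?P = "prod_list (map g [1..<Suc m])"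
  let ?h = "\<lambda>b. g(b := x * g b - g b * x)"
  have "prod_list (map (?h (Suc m)) [1..<Suc m]) = ?P"
    by (rule prod_list_upt_cong) auto
  then have "(\<Sum>b=1..Suc m. prod_list (map (?h b) [1..<Suc (Suc m)])) =
     (\<Sum>b=1..m. prod_list (map (?h b) [1..<Suc m]) * g (Suc m)) + ?P * (x * g (Suc m) - g (Suc m) * x)"
    unfolding prod_list_upt_Suc by (auto intro!: sum.cong simp del: upt_Suc)
  also have "\<dots> = (x * ?P - ?P * x) * g (Suc m) + ?P * (x * g (Suc m) - g (Suc m) * x)"
    by (simp only: Suc.IH sum_distrib_right[symmetric])
  also have "\<dots> = x * (?P * g (Suc m)) - (?P * g (Suc m)) * x"
    by (simp add: left_diff_distrib right_diff_distrib mult.assoc del: upt_Suc)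
  finally show ?case unfolding prod_list_upt_Suc ..
qed simp

lemma commutator_alt: "x * alt n g - alt n g * x = alt n (\<lambda>w. x * g w - g w * x)"
proof -
  have "x * (of_int k * y) = of_int k * (x * y)" for k y
    by (metis mult.assoc mult_of_int_commute)
  then show ?thesis
    unfolding alt_def by (simp add: sum_distrib_left sum_distrib_right right_diff_distrib sum_subtractf mult.assoc)
qed

section \<open>Invariance of the column determinant under column operations\<close>

section \<open>Column operations\<close>

context yangian
begin

text \<open>The column determinant with column b taken at u - b + 1; \<open>qdet TT\<close> is
  C_n(u), the quantum determinant.\<close>

definition qdet :: "(nat \<Rightarrow> nat \<Rightarrow> 'a fps) \<Rightarrow> 'a fps" where
  "qdet A = alt n (\<lambda>w. prod_list (map (\<lambda>b. fsh (b - 1) (A (w b) b)) [1..<Suc n]))"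

lemma colprod_Suc: "colprod f (Suc k) w = colprod f k w * fsh k (TT (w (Suc k)) (f (Suc k)))"
  by (simp add: colprod_def)

lemma qdet_TT: "qdet TT = alt n (colprod (\<lambda>b. b) n)"
  unfolding qdet_def colprod_def[abs_def] ..

text \<open>The arbitrary right factor \<open>R\<close> absorbs noncommuting coefficients and the columns after \<open>k\<close>.\<close>

definition null_column :: "nat \<Rightarrow> (nat \<Rightarrow> 'a fps) \<Rightarrow> bool" where
  "null_column k c \<longleftrightarrow> (\<forall>R. swap_invariant k R \<longrightarrow>
     alt n (\<lambda>w. colprod (\<lambda>b. b) (k - 1) w * (fsh (k - 1) (c (w k)) * R w)) = 0)"

lemma null_column_cong:
  assumes "null_column k c" "k \<in> {1..n}" "\<And>i. i \<in> {1..n} \<Longrightarrow> c' i = c i"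
  shows "null_column k c'"
proof -
  have "alt n (\<lambda>w. colprod (\<lambda>b. b) (k - 1) w * (fsh (k - 1) (c' (w k)) * R w)) =
      alt n (\<lambda>w. colprod (\<lambda>b. b) (k - 1) w * (fsh (k - 1) (c (w k)) * R w))" for R
    by (rule alt_cong) (simp only: assms(3)[OF permutes_range[OF _ assms(2)]])
  then show ?thesis using assms(1) by (simp add: null_column_def)
qed

lemma null_column_diff:
  assumes "null_column k c" "null_column k d"
  shows "null_column k (\<lambda>i. c i - d i)"
  using assms unfolding null_column_def
  by (simp add: fsh_diff left_diff_distrib right_diff_distrib alt_diff)

lemma null_column_zero: "null_column k (\<lambda>i. 0)"
  by (simp add: null_column_def)

lemma null_column_sum:
  "(\<And>l. l \<in> I \<Longrightarrow> null_column k (c l)) \<Longrightarrow> null_column k (\<lambda>i. \<Sum>l\<in>I. c l i)"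
  unfolding null_column_def by (simp add: fsh_sum sum_distrib_left sum_distrib_right alt_sum)

text \<open>The coefficient stands to the right of the column and does not depend on
  \<open>w\<close>, so it can be absorbed into \<open>R\<close>.\<close>

lemma null_column_mult:
  assumes "null_column k c"
  shows "null_column k (\<lambda>i. c i * q)"
  unfolding null_column_def
proof (intro allI impI)
  fix R assume "swap_invariant k R"
  then have "swap_invariant k (\<lambda>w. fsh (k - 1) q * R w)"
    by (simp add: swap_invariant_def)
  then show "alt n (\<lambda>w. colprod (\<lambda>b. b) (k - 1) w * (fsh (k - 1) (c (w k) * q) * R w)) = 0"
    using assms unfolding null_column_def by (simp add: fsh_mult mult.assoc)
qed

text \<open>With column \<open>j\<close> put at position \<open>k\<close>, the label
  \<open>j\<close> occurs at both positions \<open>j\<close> and \<open>k\<close>.\<close>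

lemma null_column_TT:
  assumes "1 \<le> j" "j < k" "k \<le> n"
  shows "null_column k (\<lambda>i. TT i j)"
  unfolding null_column_def
proof (intro allI impI)
  fix R assume R: "swap_invariant k R"
  let ?f = "(\<lambda>b. b)(k := j)"
  have "colprod ?f k w = colprod (\<lambda>b. b) (k - 1) w * fsh (k - 1) (TT (w k) j)" for w
  proof -
    have "colprod ?f (k - 1) w = colprod (\<lambda>b. b) (k - 1) w"
      unfolding colprod_def by (rule arg_cong[of _ _ prod_list], rule map_cong) auto
    then show ?thesis using colprod_Suc[of ?f "k - 1" w] assms by simp
  qed
  moreover have "alt n (\<lambda>w. colprod ?f k w * R w) = 0"
    by (rule alt_repeated_column[where a=j and b=k]) (use assms R in auto)
  ultimately show "alt n (\<lambda>w. colprod (\<lambda>b. b) (k - 1) w * (fsh (k - 1) (TT (w k) j) * R w)) = 0"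
    by (simp add: mult.assoc)
qed

text \<open>Columns are exchanged one at a time from the left: the first \<open>k\<close> come from
  \<open>TT\<close>, as \<open>null_column\<close> requires, and the later ones, still from
  \<open>A\<close>, form the invariant right factor.\<close>

lemma qdet_null_columns:
  assumes "\<And>k. k \<in> {1..n} \<Longrightarrow> null_column k (\<lambda>i. A i k - TT i k)"
  shows "qdet A = qdet TT"
proof -
  define rest where "rest k w = prod_list (map (\<lambda>b. fsh (b - 1) (A (w b) b)) [Suc k..<Suc n])" for k w
  have "alt n (\<lambda>w. colprod (\<lambda>b. b) k w * rest k w) = qdet A" if "k \<le> n" for k
    using that
  proof (induction k)
    case 0
    then show ?case by (simp add: qdet_def rest_def colprod_def)
  next
    case (Suc k)
    have rest: "rest k w = fsh k (A (w (Suc k)) (Suc k)) * rest (Suc k) w" for w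
      unfolding rest_def using Suc.prems by (simp add: upt_conv_Cons del: upt_Suc)
    have "swap_invariant (Suc k) (rest (Suc k))"
      unfolding swap_invariant_def rest_def
      by (auto intro!: arg_cong[of _ _ prod_list] map_cong simp del: upt_Suc)
    then have "alt n (\<lambda>w. colprod (\<lambda>b. b) k w *
        (fsh k (A (w (Suc k)) (Suc k) - TT (w (Suc k)) (Suc k)) * rest (Suc k) w)) = 0"
      using assms[of "Suc k"] Suc.prems unfolding null_column_def by simp
    then have "alt n (\<lambda>w. colprod (\<lambda>b. b) k w * rest k w) =
        alt n (\<lambda>w. colprod (\<lambda>b. b) (Suc k) w * rest (Suc k) w)"
      unfolding rest colprod_Suc
      by (simp add: fsh_diff left_diff_distrib right_diff_distrib alt_diff mult.assoc)
    then show ?case using Suc by simp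
  qed
  from this[of n] show ?thesis
    by (simp add: qdet_TT rest_def)
qed

text \<open>Unitriangularity gives G_j = T_j - sum_{l<j} G_l U_lj for the columns; induct on
  \<open>j\<close>.\<close>

lemma null_column_triangular_factor:
  assumes "\<And>i j. i \<in> {1..n} \<Longrightarrow> j \<in> {1..n} \<Longrightarrow> TT i j = (\<Sum>k=1..j. G i k * U k j)"
    and "\<And>j. j \<in> {1..n} \<Longrightarrow> U j j = 1"
    and "k \<le> n" "1 \<le> j" "j < k"
  shows "null_column k (\<lambda>i. G i j)"
  using assms(4,5)
proof (induction j rule: less_induct)
  case (less j)
  have "null_column k (\<lambda>i. TT i j - (\<Sum>l\<in>{1..<j}. G i l * U l j))"
    using less assms(3) by (intro null_column_diff null_column_TT null_column_sum null_column_mult) auto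
  then show ?case
  proof (rule null_column_cong)
    fix i assume "i \<in> {1..n}"
    moreover have "{1..j} = insert j {1..<j}" using less.prems by auto
    ultimately show "G i j = TT i j - (\<Sum>l\<in>{1..<j}. G i l * U l j)"
      using assms(1)[of i j] assms(2)[of j] assms(3) less.prems by simp
  qed (use less assms(3) in auto)
qed

text \<open>In A_k - T_k the terms with l = k cancel, which leaves a right combination of the
  columns G_l with l < k.\<close>

lemma qdet_triangular_factor:
  assumes T: "\<And>i j. i \<in> {1..n} \<Longrightarrow> j \<in> {1..n} \<Longrightarrow> TT i j = (\<Sum>k=1..j. G i k * U k j)"
    and U: "\<And>j. j \<in> {1..n} \<Longrightarrow> U j j = 1"
    and A: "\<And>i j. i \<in> {1..n} \<Longrightarrow> j \<in> {1..n} \<Longrightarrow> A i j = (\<Sum>k=1..j. G i k * V k j)"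
    and V: "\<And>j. j \<in> {1..n} \<Longrightarrow> V j j = 1"
  shows "qdet A = qdet TT"
proof (rule qdet_null_columns)
  fix k assume k: "k \<in> {1..n}"
  have "null_column k (\<lambda>i. \<Sum>l\<in>{1..<k}. G i l * (V l k - U l k))"
    using null_column_triangular_factor[OF T U] k
    by (intro null_column_sum null_column_mult) auto
  then show "null_column k (\<lambda>i. A i k - TT i k)"
  proof (rule null_column_cong[OF _ k])
    fix i assume "i \<in> {1..n}"
    moreover have "{1..k} = insert k {1..<k}" using k by auto
    ultimately show "A i k - TT i k = (\<Sum>l\<in>{1..<k}. G i l * (V l k - U l k))"
      using T[of i k] A[of i k] U[of k] V[of k] k
      by (simp add: right_diff_distrib sum_subtractf)
  qed
qed

section \<open>Centrality of the quantum determinant\<close>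

section \<open>Centrality\<close>

lemma bracket_first_order_series:
  assumes "i \<in> {1..n}" "j \<in> {1..n}" "k \<in> {1..n}" "l \<in> {1..n}"
  shows "fps_const (t i j 1) * TT k l - TT k l * fps_const (t i j 1) =
    (if k = j then TT i l else 0) - (if i = l then TT k j else 0)"
proof -
  have "fps_X * (fps_const (t i j 1) * TT k l - TT k l * fps_const (t i j 1)) =
     fps_X * ((if k = j then TT i l else 0) - (if i = l then TT k j else 0))"
    using series_commutator_step[OF assms, of 0] by (auto simp: Tc_def)
  then show ?thesis by (rule fps_X_cancel_left)
qed

lemma bracket_first_order:
  assumes "i \<in> {1..n}" "j \<in> {1..n}" "k \<in> {1..n}" "l \<in> {1..n}"
  shows "t i j 1 * Tc t k l s - Tc t k l s * t i j 1 =
    (if k = j then Tc t i l s else 0) - (if i = l then Tc t k j s else 0)"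
  using arg_cong[OF bracket_first_order_series[OF assms], of "\<lambda>f. f $ s"]
  by (auto simp: TT_nth split: if_splits)

text \<open>By the Leibniz rule the bracket splits into two parts: one has row j replaced by row i,
  the other column i by column j. Both determinants have a repetition and vanish.\<close>

lemma qdet_commutes_first_order:
  assumes i: "i \<in> {1..n}" and j: "j \<in> {1..n}" and ij: "i \<noteq> j"
  shows "fps_const (t i j 1) * qdet TT = qdet TT * fps_const (t i j 1)"
proof -
  let ?x = "fps_const (t i j 1)"
  let ?g = "\<lambda>w b. fsh (b - 1) (TT (w b) b)"
  let ?P = "\<lambda>g. prod_list (map g [1..<Suc n])"
  let ?r = "\<lambda>w b. fsh (b - 1) (TT (if w b = j then i else w b) b)"
  have "?x * qdet TT - qdet TT * ?x = alt n (\<lambda>w. \<Sum>b=1..n. ?P ((?g w)(b := ?x * ?g w b - ?g w b * ?x)))"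
    unfolding qdet_def commutator_alt commutator_prod_list ..
  also have "\<dots> = alt n (\<lambda>w. ?P (?r w) - colprod ((\<lambda>b. b)(i := j)) n w)"
  proof (rule alt_cong)
    fix w assume w: "w permutes {1..n}"
    \<comment> \<open>\<open>b0\<close> is the unique column in which \<open>w\<close> picks row
      \<open>j\<close>, hence the only place where the first bracket term survives.\<close>
    define b0 where "b0 = inv w j"
    have b0: "b0 \<in> {1..n}" "w b = j \<longleftrightarrow> b = b0" for b
      using permutes_range[OF permutes_inv[OF w] j] permutes_inv_eq[OF w, of j b] by (auto simp: b0_def)
    have br: "?x * ?g w b - ?g w b * ?x =
        (if b = b0 then fsh (b - 1) (TT i b) else 0) - (if b = i then fsh (b - 1) (TT (w b) j) else 0)"
      if "b \<in> {1..n}" for b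
    proof -
      have "?x * ?g w b - ?g w b * ?x = fsh (b - 1) (?x * TT (w b) b - TT (w b) b * ?x)"
        by (simp add: fsh_diff fsh_const_mult fsh_mult_const)
      also have "\<dots> = fsh (b - 1) ((if w b = j then TT i b else 0) - (if i = b then TT (w b) j else 0))"
        by (simp only: bracket_first_order_series[OF i j permutes_range[OF w that] that])
      finally show ?thesis
        unfolding b0(2) by (simp add: fsh_diff)
    qed
    have zero: "?P (h(b := 0)) = 0" if "b \<in> {1..n}" for h :: "nat \<Rightarrow> 'a fps" and b
      using that by (intro prod_list_upt_zero[of b]) auto
    have "(\<Sum>b=1..n. ?P ((?g w)(b := ?x * ?g w b - ?g w b * ?x))) =
        (\<Sum>b=1..n. ?P ((?g w)(b := if b = b0 then fsh (b - 1) (TT i b) else 0)))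
        - (\<Sum>b=1..n. ?P ((?g w)(b := if b = i then fsh (b - 1) (TT (w b) j) else 0)))"
      unfolding sum_subtractf[symmetric]
      by (intro sum.cong refl) (simp only: br prod_list_upt_diff atLeastAtMost_iff)
    also have "(\<Sum>b=1..n. ?P ((?g w)(b := if b = b0 then fsh (b - 1) (TT i b) else 0))) =
        (\<Sum>b=1..n. if b = b0 then ?P ((?g w)(b0 := fsh (b0 - 1) (TT i b0))) else 0)"
      by (intro sum.cong refl) (simp add: zero del: upt_Suc One_nat_def)
    also have "\<dots> = ?P ((?g w)(b0 := fsh (b0 - 1) (TT i b0)))"
      using b0(1) by simp
    also have "\<dots> = ?P (?r w)"
      by (intro arg_cong[of _ _ prod_list] map_cong refl) (auto simp: b0(2))
    also have "(\<Sum>b=1..n. ?P ((?g w)(b := if b = i then fsh (b - 1) (TT (w b) j) else 0))) =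
        (\<Sum>b=1..n. if b = i then ?P ((?g w)(i := fsh (i - 1) (TT (w i) j))) else 0)"
      by (intro sum.cong refl) (simp add: zero del: upt_Suc One_nat_def)
    also have "\<dots> = ?P ((?g w)(i := fsh (i - 1) (TT (w i) j)))"
      using i by simp
    also have "\<dots> = colprod ((\<lambda>b. b)(i := j)) n w"
      unfolding colprod_def by (intro arg_cong[of _ _ prod_list] map_cong refl) auto
    finally show "(\<Sum>b=1..n. ?P ((?g w)(b := ?x * ?g w b - ?g w b * ?x))) =
      ?P (?r w) - colprod ((\<lambda>b. b)(i := j)) n w" .
  qed
  also have "alt n (\<lambda>w. ?P (?r w) - colprod ((\<lambda>b. b)(i := j)) n w) = 0"
  proof -
    \<comment> \<open>In \<open>?r\<close> the values i and j of \<open>w\<close> both select row i,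
      so exchanging them changes nothing.\<close>
    have "alt n (\<lambda>w. ?P (?r w)) = 0"
    proof (rule alt_row_vanish[OF i j ij])
      fix w :: "nat \<Rightarrow> nat"
      have "(if (transpose i j \<circ> w) b = j then i else (transpose i j \<circ> w) b) = (if w b = j then i else w b)" for b
        using ij by (auto simp: transpose_def)
      then show "?P (?r (transpose i j \<circ> w)) = ?P (?r w)" by simp
    qed
    moreover have "alt n (\<lambda>w. colprod ((\<lambda>b. b)(i := j)) n w * 1) = 0"
      by (rule alt_repeated_column[where a="min i j" and b="max i j"])
        (use i j ij in \<open>auto simp: swap_invariant_def min_def max_def\<close>)
    ultimately show ?thesis by (simp add: alt_diff)
  qed
  finally show ?thesis by simp
qed

text \<open>With all four indices equal to 1, every term on the right of the recursion is a
  commutator of the previous degree.\<close>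

lemma TT_11_commute:
  assumes "1 \<le> n"
  shows "fps_const (Tc t 1 1 r) * TT 1 1 = TT 1 1 * fps_const (Tc t 1 1 r)"
proof (induction r)
  case 0 then show ?case by (simp add: Tc_def)
next
  case (Suc r)
  have "1 \<in> {1..n}" using assms by simp
  note series_commutator_step[OF this this this this, of r]
  then have "fps_X * (fps_const (Tc t 1 1 (Suc r)) * TT 1 1) = fps_X * (TT 1 1 * fps_const (Tc t 1 1 (Suc r)))"
    using Suc by (simp add: right_diff_distrib)
  then show ?case by (rule fps_X_cancel_left)
qed

definition inv11 :: "'a fps" where
  "inv11 = fps_right_inverse (TT 1 1) 1"

lemma inv11: "TT 1 1 * inv11 = 1" "inv11 * TT 1 1 = 1"
  unfolding inv11_def
  by (rule fps_right_inverse fps_left_inverse'[of 1]; simp add: TT_nth_0)+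

text \<open>The quasideterminant of the 2 by 2 submatrix on rows 1, i and columns 1, j.\<close>

definition schur :: "nat \<Rightarrow> nat \<Rightarrow> 'a fps" where
  "schur i j = TT i j - TT i 1 * inv11 * TT 1 j"

text \<open>With S the quasideterminant, the recursion becomes u^{-1} [T_11^(r+1), S] =
  [T_11^(r), S], whose right side is zero by induction: the correction terms of T_ij and of T_i1
  T_11^{-1} T_1j agree.\<close>

lemma schur_commutes_11:
  assumes i: "i \<in> {1..n}" and j: "j \<in> {1..n}"
  shows "fps_const (Tc t 1 1 r) * schur i j = schur i j * fps_const (Tc t 1 1 r)"
proof (induction r)
  case 0 then show ?case by (simp add: Tc_def)
next
  case (Suc r)
  have 1: "1 \<in> {1..n}" using i by simp
  define b c d where "b = TT 1 j" and "c = TT i 1" and "d = TT i j"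
  define x y where "x = fps_const (Tc t 1 1 r)" and "y = fps_const (Tc t 1 1 (Suc r))"
  define p q where "p = fps_const (Tc t 1 j r)" and "q = fps_const (Tc t i 1 r)"
  define a where "a = TT 1 1"
  note rels = series_commutator_step[OF 1 1, of _ _ r, folded x_def y_def]
  have B: "fps_X * (y * b - b * y) = x * b - b * x + fps_X * (x * b - a * p)"
    using rels[OF 1 j] by (simp add: b_def a_def p_def x_def)
  have Cc: "fps_X * (y * c - c * y) = x * c - c * x + fps_X * (q * a - c * x)"
    using rels[OF i 1] by (simp add: c_def a_def q_def x_def)
  have Dd: "fps_X * (y * d - d * y) = x * d - d * x + fps_X * (q * b - c * p)"
    using rels[OF i j] by (simp add: b_def c_def d_def q_def p_def)
  have ai: "a * inv11 = 1" "inv11 * a = 1" using inv11 by (simp_all add: a_def)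
  have com: "inv11 * z = z * inv11" if "z * a = a * z" for z
    by (metis ai mult.assoc mult.right_neutral mult.left_neutral that)
  have ya: "inv11 * y = y * inv11" and xa: "inv11 * x = x * inv11"
    using TT_11_commute 1 by (auto intro!: com simp: a_def y_def x_def)
  define e where "e = inv11 * b"
  have Ee: "fps_X * (y * e - e * y) = x * e - e * x + fps_X * (inv11 * x * b - p)"
  proof -
    have comm: "inv11 * (y * z) = y * (inv11 * z)" "inv11 * (x * z) = x * (inv11 * z)" for z
      using xa ya by (simp_all flip: mult.assoc)
    have "fps_X * (y * e - e * y) = inv11 * (fps_X * (y * b - b * y))"
      by (simp add: e_def right_diff_distrib fps_X_left_commute comm mult.assoc)
    also have "\<dots> = inv11 * (x * b - b * x) + fps_X * (inv11 * x * b - inv11 * a * p)"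
      unfolding B distrib_left fps_X_left_commute[of inv11] by (simp add: right_diff_distrib mult.assoc)
    also have "inv11 * (x * b - b * x) = x * e - e * x"
      by (simp add: e_def right_diff_distrib comm mult.assoc)
    finally show ?thesis by (simp add: ai)
  qed
  have "fps_X * (y * (c * e) - c * e * y) = fps_X * (y * c - c * y) * e + c * (fps_X * (y * e - e * y))"
    by (simp add: algebra_simps fps_X_left_commute)
  \<comment> \<open>The terms in x cancel because x commutes with \<open>inv11\<close>, and a e = b
    turns the rest into q b - c p, the correction that also occurs in \<open>Dd\<close>.\<close>
  also have "\<dots> = x * (c * e) - c * e * x + fps_X * (q * (a * e) - c * p) + fps_X * (c * (inv11 * x * b - x * e))"
    unfolding Cc Ee by (simp add: algebra_simps fps_X_left_commute)
  also have "a * e = b" by (simp add: e_def ai flip: mult.assoc)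
  also have "inv11 * x * b - x * e = 0" by (simp add: e_def xa mult.assoc)
  finally have CE: "fps_X * (y * (c * e) - c * e * y) = x * (c * e) - c * e * x + fps_X * (q * b - c * p)"
    by simp
  have "fps_X * (y * (d - c * e) - (d - c * e) * y) =
      fps_X * (y * d - d * y) - fps_X * (y * (c * e) - c * e * y)"
    by (simp add: algebra_simps)
  also have "\<dots> = x * (d - c * e) - (d - c * e) * x"
    unfolding Dd CE by (simp add: algebra_simps)
  finally have "fps_X * (y * (d - c * e) - (d - c * e) * y) = x * (d - c * e) - (d - c * e) * x" .
  moreover have S: "schur i j = d - c * e" by (simp add: schur_def b_def c_def d_def e_def mult.assoc)
  ultimately have "fps_X * (y * (d - c * e) - (d - c * e) * y) = 0"
    using Suc by (simp add: x_def)
  then have "y * (d - c * e) - (d - c * e) * y = 0"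
    using fps_X_cancel_left[of _ 0] by (simp only: mult_zero_right)
  then show ?case by (simp only: S y_def right_minus_eq)
qed

lemma commutes_alt:
  "(\<And>w. w permutes {1..n} \<Longrightarrow> x * g w = g w * x) \<Longrightarrow> x * alt n g = alt n g * x"
  using commutator_alt[of x n g] alt_cong[of n "\<lambda>w. x * g w - g w * x" "\<lambda>w. 0"] by simp

lemma commutes_prod_list:
  "(\<And>y. y \<in> set ys \<Longrightarrow> x * y = y * (x :: 'r::monoid_mult)) \<Longrightarrow> x * prod_list ys = prod_list ys * x"
proof (induction ys)
  case (Cons y ys)
  then show ?case by simp (metis mult.assoc)
qed simp

text \<open>Subtracting right multiples of column 1 replaces every later column by quasideterminants
  and clears row 1 outside its first entry. Only permutations fixing 1 contribute, and each of their
  factors commutes with T_11^(r).\<close>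

lemma qdet_commutes_11:
  assumes "1 \<le> n"
  shows "fps_const (Tc t 1 1 r) * qdet TT = qdet TT * fps_const (Tc t 1 1 r)"
proof -
  let ?x = "fps_const (Tc t 1 1 r)"
  define A where "A i j = (if j = 1 then TT i 1 else schur i j)" for i j
  have "qdet A = qdet TT"
  proof (rule qdet_null_columns)
    fix k assume k: "k \<in> {1..n}"
    show "null_column k (\<lambda>i. A i k - TT i k)"
    proof (cases "k = 1")
      case True
      then show ?thesis by (simp add: A_def null_column_zero)
    next
      case False
      then have "null_column k (\<lambda>i. 0 - TT i 1 * (inv11 * TT 1 k))"
        using k by (intro null_column_diff null_column_zero null_column_mult null_column_TT) auto
      then show ?thesis using False by (simp add: A_def schur_def mult.assoc)
    qed
  qed
  moreover have "?x * qdet A = qdet A * ?x"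
    unfolding qdet_def
  proof (rule commutes_alt)
    fix w assume w: "w permutes {1..n}"
    let ?g = "\<lambda>b. fsh (b - 1) (A (w b) b)"
    have one: "1 \<in> {1..n}" using assms by simp
    show "?x * prod_list (map ?g [1..<Suc n]) = prod_list (map ?g [1..<Suc n]) * ?x"
    proof (cases "w 1 = 1")
      case True
      have "?x * ?g b = ?g b * ?x" if "b \<in> {1..n}" for b
      proof -
        have "?x * A (w b) b = A (w b) b * ?x"
          using schur_commutes_11[OF permutes_range[OF w that] that] TT_11_commute[OF assms] True
          by (simp add: A_def)
        from arg_cong[OF this, of "fsh (b - 1)"] show ?thesis
          by (simp add: fsh_const_mult fsh_mult_const)
      qed
      then show ?thesis by (intro commutes_prod_list) auto
    next
      case False
      define b where "b = inv w 1"
      have b: "w b = 1" "b \<in> {1..n}"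
        using permutes_inverses(1)[OF w] permutes_range[OF permutes_inv[OF w] one] by (auto simp: b_def)
      then have "b \<noteq> 1" using False by auto
      \<comment> \<open>Here T_11 T_11^{-1} T_1b = T_1b: the cleared row.\<close>
      moreover have "schur 1 b = 0"
        unfolding schur_def inv11 by simp
      ultimately have "?g b = 0"
        by (simp only: b A_def if_False fsh_0)
      then have "prod_list (map ?g [1..<Suc n]) = 0"
        using b by (intro prod_list_upt_zero[of b]) auto
      then show ?thesis by simp
    qed
  qed
  ultimately show ?thesis by simp
qed

lemma commutes_commutator:
  "z * x = x * z \<Longrightarrow> z * y = y * z \<Longrightarrow> z * (x * y - y * x) = (x * y - y * x) * (z :: 'r::ring)"
  by (simp add: right_diff_distrib left_diff_distrib) (metis mult.assoc)

text \<open>Up to sign and a diagonal term T_11^(s), the brackets with T_1l^(1) and then T_k1^(1)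
  carry T_11^(s) to T_1l^(s) and on to T_kl^(s).\<close>

lemma commutes_generators:
  assumes first: "\<And>i j. i \<in> {1..n} \<Longrightarrow> j \<in> {1..n} \<Longrightarrow> i \<noteq> j \<Longrightarrow> z * t i j 1 = t i j 1 * z"
    and T11: "\<And>s. 1 \<le> n \<Longrightarrow> z * Tc t 1 1 s = Tc t 1 1 s * z"
    and k: "k \<in> {1..n}" and l: "l \<in> {1..n}"
  shows "z * Tc t k l s = Tc t k l s * z"
proof -
  have one: "1 \<in> {1..n}" and "1 \<le> n" using k by auto
  note T11 = T11[OF this(2)]
  have row: "z * Tc t 1 l s = Tc t 1 l s * z" if "l \<in> {1..n}" for l
  proof (cases "l = 1")
    case False
    then have "Tc t 1 l s = - (t 1 l 1 * Tc t 1 1 s - Tc t 1 1 s * t 1 l 1)"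
      using bracket_first_order[OF one that one one, of s] by simp
    moreover have "z * (t 1 l 1 * Tc t 1 1 s - Tc t 1 1 s * t 1 l 1) =
        (t 1 l 1 * Tc t 1 1 s - Tc t 1 1 s * t 1 l 1) * z"
      using commutes_commutator[OF first[OF one that] T11[of s]] False by simp
    ultimately show ?thesis
      by (simp only: mult_minus_left mult_minus_right)
  qed (use T11 in simp)
  show ?thesis
  proof (cases "k = 1")
    case True then show ?thesis using row[OF l] by simp
  next
    case False
    have "Tc t k l s = t k 1 1 * Tc t 1 l s - Tc t 1 l s * t k 1 1 + (if k = l then Tc t 1 1 s else 0)"
      using bracket_first_order[OF k one one l, of s] by simp
    then show ?thesis
      using commutes_commutator[OF first[OF k one False] row[OF l]] T11[of s]
      by (simp add: distrib_left distrib_right)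
  qed
qed

lemma qdet_central:
  assumes "k \<in> {1..n}" and "l \<in> {1..n}"
  shows "qdet TT $ m * Tc t k l s = Tc t k l s * qdet TT $ m"
proof (rule commutes_generators[OF _ _ assms])
  fix i j assume "i \<in> {1..n}" "j \<in> {1..n}" "i \<noteq> j"
  from arg_cong[OF qdet_commutes_first_order[OF this], of "\<lambda>f. f $ m"]
  show "qdet TT $ m * t i j 1 = t i j 1 * qdet TT $ m" by simp
next
  fix s assume "1 \<le> n"
  from arg_cong[OF qdet_commutes_11[OF this, of s], of "\<lambda>f. f $ m"]
  show "qdet TT $ m * Tc t 1 1 s = Tc t 1 1 s * qdet TT $ m" by simp
qed

end

section \<open>Gauss factors as series, and the lower factor for an upper triangular shift\<close>

section \<open>The Gauss factorization\<close>

lemma Abs_fps_smul: "Abs_fps (smul a b) = Abs_fps a * Abs_fps b"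
  by (rule fps_ext) (simp add: smul_def fps_mult_nth atMost_atLeast0)

lemma Abs_fps_sone: "Abs_fps sone = 1"
  by (rule fps_ext) (simp add: sone_def)

lemma sprod_list_nth: "sprod_list xs m = prod_list (map Abs_fps xs) $ m"
proof -
  have "Abs_fps (sprod_list xs) = prod_list (map Abs_fps xs)"
    by (induction xs) (simp_all add: Abs_fps_sone Abs_fps_smul)
  then show ?thesis by (metis fps_nth_Abs_fps)
qed

lemma fps_mult_nth_Suc_0: "(f * g) $ Suc 0 = f $ 0 * g $ Suc 0 + f $ Suc 0 * g $ 0"
  by (simp add: fps_mult_nth)

lemma fps_mult_left_cancel:
  assumes "d $ 0 = 1" "d * f = d * (g :: 'a::ring_1 fps)"
  shows "f = g"
proof -
  have "fps_left_inverse d 1 * d = 1"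
    by (rule fps_left_inverse) (simp add: assms)
  then show ?thesis using assms(2) by (metis mult.assoc mult.left_neutral)
qed

lemma fps_mult_right_cancel:
  assumes "d $ 0 = 1" "f * d = (g :: 'a::ring_1 fps) * d"
  shows "f = g"
proof -
  have "d * fps_right_inverse d 1 = 1"
    by (rule fps_right_inverse) (simp add: assms)
  then show ?thesis using assms(2) by (metis mult.assoc mult.right_neutral)
qed

lemma commutes_mult:
  "z * f = f * z \<Longrightarrow> z * g = g * z \<Longrightarrow> z * (f * g) = f * g * (z :: 'r::semigroup_mult)"
  by (metis mult.assoc)

lemma commutes_left_factor:
  assumes "(d :: 'a::ring_1 fps) $ 0 = 1" "z * d = d * z" "z * (d * f) = d * f * z"
  shows "z * f = f * z"
  by (rule fps_mult_left_cancel[OF assms(1)]) (metis assms(2,3) mult.assoc)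

lemma commutes_right_factor:
  assumes "(d :: 'a::ring_1 fps) $ 0 = 1" "z * d = d * z" "z * (f * d) = f * d * z"
  shows "z * f = f * z"
  by (rule fps_mult_right_cancel[OF assms(1)]) (metis assms(2,3) mult.assoc)

lemma commutes_diff_sum:
  assumes "z * f = f * z" "\<And>l. l \<in> I \<Longrightarrow> z * g l = g l * (z :: 'r::ring)"
  shows "z * (f - sum g I) = (f - sum g I) * z"
  using assms(1) assms(2) by (simp add: left_diff_distrib right_diff_distrib sum_distrib_left sum_distrib_right)

lemma fps_const_commute_iff:
  "fps_const z * f = f * fps_const z \<longleftrightarrow> (\<forall>m. z * f $ m = f $ m * (z :: 'a::ring_1))"
  by (simp add: fps_eq_iff)

context yangian
begin

lemma cdet_qdet: "cdet n (\<lambda>i j. sshift (j - 1) (X i j)) m = qdet (\<lambda>i j. Abs_fps (X i j)) $ m"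
proof -
  have "fps_nth (Abs_fps x) = x" for x :: "nat \<Rightarrow> 'a"
    by (rule ext) simp
  then show ?thesis
    unfolding cdet_def qdet_def alt_def fps_sum_nth sprod_list_nth
    by (simp add: fsh_def o_def del: upt_Suc flip: fps_of_int)
qed

end

locale yangian_gauss = yangian n t for n and t :: "nat \<Rightarrow> nat \<Rightarrow> nat \<Rightarrow> 'a::ring_1" +
  fixes D :: "nat \<Rightarrow> nat \<Rightarrow> 'a" and E F :: "nat \<Rightarrow> nat \<Rightarrow> nat \<Rightarrow> 'a"
  assumes gauss: "gauss n (Tc t) D E F"
begin

definition DD :: "nat \<Rightarrow> 'a fps" where "DD k = Abs_fps (D k)"
definition EE :: "nat \<Rightarrow> nat \<Rightarrow> 'a fps" where "EE k j = Abs_fps (unit_entry E k j)"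
text \<open>The indices are transposed: this is the entry of the lower factor in row
  \<open>i\<close> and column \<open>k\<close>.\<close>

definition FF :: "nat \<Rightarrow> nat \<Rightarrow> 'a fps" where "FF k i = Abs_fps (unit_entry F k i)"

lemma EE_same [simp]: "EE k k = 1" and FF_same [simp]: "FF k k = 1"
  by (simp_all add: EE_def FF_def unit_entry_def Abs_fps_sone)

lemma DD_nth_0: "k \<in> {1..n} \<Longrightarrow> DD k $ 0 = 1"
  using gauss by (simp add: gauss_def DD_def)

lemma EE_nth_0: "1 \<le> i \<Longrightarrow> i < j \<Longrightarrow> j \<le> n \<Longrightarrow> EE i j $ 0 = 0"
  and FF_nth_0: "1 \<le> i \<Longrightarrow> i < j \<Longrightarrow> j \<le> n \<Longrightarrow> FF i j $ 0 = 0"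
  using gauss by (simp_all add: gauss_def EE_def FF_def unit_entry_def)

lemma TT_gauss:
  assumes "i \<in> {1..n}" "j \<in> {1..n}"
  shows "TT i j = (\<Sum>k=1..min i j. FF k i * DD k * EE k j)"
proof (rule fps_ext)
  fix m
  have "smul (unit_entry F k i) (smul (D k) (unit_entry E k j)) m = (FF k i * DD k * EE k j) $ m" for k
    by (metis Abs_fps_smul DD_def EE_def FF_def fps_nth_Abs_fps mult.assoc)
  then show "TT i j $ m = (\<Sum>k=1..min i j. FF k i * DD k * EE k j) $ m"
    using gauss assms unfolding gauss_def TT_nth fps_sum_nth by auto
qed

text \<open>An entry with min i j = k is F_{k,i} D_k E_{k,j} plus terms from earlier factors, so
  induction on \<open>k\<close> isolates that product; invertibility of D_k separates its factors.
  Taking p = n serves centrality, a smaller block serves \<open>FF_bracket\<close>.\<close>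

lemma commutes_gauss:
  assumes z: "\<And>k l. k \<in> {1..p} \<Longrightarrow> l \<in> {1..p} \<Longrightarrow> z * TT k l = TT k l * z" and p: "p \<le> n"
  shows "1 \<le> k \<Longrightarrow> k \<le> p \<Longrightarrow> z * DD k = DD k * z \<and>
    (\<forall>j\<in>{k..p}. z * EE k j = EE k j * z \<and> z * FF k j = FF k j * z)"
proof (induction k rule: less_induct)
  case (less k)
  have prev: "z * (FF l i * DD l * EE l j) = FF l i * DD l * EE l j * z"
    if "l \<in> {1..<k}" "i \<in> {k..p}" "j \<in> {k..p}" for l i j
    using less.IH[of l] that less.prems by (intro commutes_mult) auto
  have last: "(\<Sum>l=1..k. g l) = g k + (\<Sum>l\<in>{1..<k}. g l)" for g :: "nat \<Rightarrow> 'a fps"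
  proof -
    have "{1..k} = insert k {1..<k}" using less.prems by auto
    then show ?thesis by simp
  qed
  have part: "z * (FF k i * DD k * EE k j) = FF k i * DD k * EE k j * z"
    if ij: "i \<in> {k..p}" "j \<in> {k..p}" "min i j = k" for i j
  proof -
    have mem: "i \<in> {1..n}" "j \<in> {1..n}" "i \<in> {1..p}" "j \<in> {1..p}" using ij less.prems p by auto
    have eq: "FF k i * DD k * EE k j = TT i j - (\<Sum>l\<in>{1..<k}. FF l i * DD l * EE l j)"
      unfolding TT_gauss[OF mem(1,2)] ij(3) last by simp
    show ?thesis
      unfolding eq by (rule commutes_diff_sum[OF z[OF mem(3,4)] prev[OF _ ij(1,2)]])
  qed
  have k: "k \<in> {k..p}" "DD k $ 0 = 1" using less.prems p DD_nth_0 by auto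
  have d: "z * DD k = DD k * z"
    using part[of k k] k by simp
  moreover have "z * EE k j = EE k j * z \<and> z * FF k j = FF k j * z" if "j \<in> {k..p}" for j
  proof
    show "z * EE k j = EE k j * z"
      by (rule commutes_left_factor[OF k(2) d]) (use part[of k j] k that in auto)
    show "z * FF k j = FF k j * z"
      by (rule commutes_right_factor[OF k(2) d]) (use part[of j k] k that in auto)
  qed
  ultimately show ?case by blast
qed

text \<open>For l < k both off-diagonal factors lack a constant term, so their product starts in
  degree 2.\<close>

lemma F_subdiagonal_1:
  assumes "1 \<le> k" "Suc k \<le> n"
  shows "F k (Suc k) 1 = t (Suc k) k 1"
proof -
  have "(FF l (Suc k) * DD l * EE l k) $ Suc 0 = 0" if "l \<in> {1..<k}" for l
    using that assms EE_nth_0[of l k] FF_nth_0[of l "Suc k"] by (simp add: fps_mult_nth_Suc_0)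
  moreover have "{1..k} = insert k {1..<k}" using assms by auto
  moreover have "TT (Suc k) k = (\<Sum>l=1..k. FF l (Suc k) * DD l * EE l k)"
    using TT_gauss[of "Suc k" k] assms by simp
  ultimately have "TT (Suc k) k $ Suc 0 = (FF k (Suc k) * DD k) $ Suc 0"
    by (simp add: fps_sum_nth)
  then show ?thesis
    using DD_nth_0[of k] FF_nth_0[of k "Suc k"] assms
    by (simp add: fps_mult_nth_Suc_0 TT_nth Tc_def) (simp add: FF_def unit_entry_def)
qed

text \<open>The bracket with T_{m+1,m}^(1) sends T_{m,i} to T_{m+1,i}. That element commutes with
  the upper left block of size m - 1, hence with D_k and E_{k,i} for k <= i < m, and so acts on the
  lower factor alone. Induction on \<open>i\<close> isolates the term k = i, and D_i
  cancels.\<close>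

lemma FF_bracket:
  assumes "1 \<le> i" "i < m" "Suc m \<le> n"
  shows "fps_const (t (Suc m) m 1) * FF i m - FF i m * fps_const (t (Suc m) m 1) = FF i (Suc m)"
  using assms(1,2)
proof (induction i rule: less_induct)
  case (less i)
  let ?x = "fps_const (t (Suc m) m 1)"
  have mem: "i \<in> {1..n}" "m \<in> {1..n}" "Suc m \<in> {1..n}" using less.prems assms by auto
  have comm: "?x * TT k l = TT k l * ?x" if "k \<in> {1..m - 1}" "l \<in> {1..m - 1}" for k l
  proof -
    have "k \<in> {1..n}" "l \<in> {1..n}" "k \<noteq> m" "Suc m \<noteq> l" using that assms(3) by auto
    then show ?thesis using bracket_first_order_series[OF mem(3,2), of k l] by simp
  qed
  have cm: "?x * (DD k * EE k i) = DD k * EE k i * ?x" if "k \<in> {1..i}" for k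
    using commutes_gauss[where p="m - 1", OF comm, of k] that less.prems assms(3)
    by (intro commutes_mult) auto
  have D0: "DD i $ 0 = 1" using DD_nth_0 mem by simp
  have split: "(\<Sum>l=1..i. g l) = g i + (\<Sum>l\<in>{1..<i}. g l)" for g :: "nat \<Rightarrow> 'a fps"
  proof -
    have "{1..i} = insert i {1..<i}" using less.prems by auto
    then show ?thesis by simp
  qed
  have "TT (Suc m) i = ?x * TT m i - TT m i * ?x"
    using bracket_first_order_series[OF mem(3,2,2,1)] less.prems by simp
  also have "TT m i = (\<Sum>k=1..i. FF k m * (DD k * EE k i))"
    using TT_gauss[OF mem(2,1)] less.prems by (simp add: min_def mult.assoc)
  also have "?x * \<dots> - \<dots> * ?x = (\<Sum>k=1..i. (?x * FF k m - FF k m * ?x) * (DD k * EE k i))"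
    unfolding sum_distrib_left sum_distrib_right sum_subtractf[symmetric]
    by (rule sum.cong[OF refl]) (simp add: left_diff_distrib mult.assoc cm[unfolded mult.assoc] del: One_nat_def)
  also have "\<dots> = (?x * FF i m - FF i m * ?x) * DD i + (\<Sum>k\<in>{1..<i}. FF k (Suc m) * (DD k * EE k i))"
    unfolding split using less by simp
  finally have "(?x * FF i m - FF i m * ?x) * DD i =
      TT (Suc m) i - (\<Sum>k\<in>{1..<i}. FF k (Suc m) * (DD k * EE k i))"
    by simp
  also have "TT (Suc m) i = (\<Sum>k=1..i. FF k (Suc m) * (DD k * EE k i))"
    using TT_gauss[OF mem(3,1)] less.prems by (simp add: min_def mult.assoc)
  finally have "(?x * FF i m - FF i m * ?x) * DD i = FF i (Suc m) * DD i"
    unfolding split by simp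
  then show ?case by (rule fps_mult_right_cancel[OF D0])
qed

text \<open>With zero shift the recursion keeps the degree and brackets with F_{j-1}^(1), exactly as
  in \<open>FF_bracket\<close>.\<close>

lemma sF_aux_eq:
  assumes upper: "\<And>j. j \<in> {2..n} \<Longrightarrow> s j (j - 1) = 0" and i: "1 \<le> i"
  shows "i + d + 1 \<le> n \<Longrightarrow> sF_aux s F i d r = F i (i + d + 1) r"
proof (induction d)
  case (Suc d)
  let ?m = "i + d + 1"
  have "F ?m (Suc ?m) 1 * F i ?m r - F i ?m r * F ?m (Suc ?m) 1 = F i (Suc ?m) r"
    using arg_cong[OF FF_bracket[of i ?m], of "\<lambda>f. f $ r"] i Suc.prems F_subdiagonal_1[of ?m]
    by (simp add: FF_def unit_entry_def)
  moreover have "s (i + d + 2) (i + d + 1) = 0" using upper[of "i + d + 2"] Suc.prems by simp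
  ultimately show ?case using Suc by (simp add: Let_def)
qed simp

text \<open>Since s_{j,i} = 0, only the constant term is cut off, and this is zero in F_{i,j}(u) as
  well.\<close>

lemma sFser_eq:
  assumes upper: "\<forall>i\<in>{1..n}. \<forall>j\<in>{1..n}. j < i \<longrightarrow> s i j = 0" and "1 \<le> i" "i \<le> j" "j \<le> n"
  shows "Abs_fps (sFser s F i j) = FF i j"
proof (rule fps_ext)
  fix r
  show "Abs_fps (sFser s F i j) $ r = FF i j $ r"
  proof (cases "i = j")
    case False
    have "s j (j - 1) = 0" if "j \<in> {2..n}" for j
      using upper[rule_format, of j "j - 1"] that by auto
    then have "s j i = 0" "sF_aux s F i (j - i - 1) r = F i j r"
      using False assms sF_aux_eq[of s i "j - i - 1" r] by auto
    then show ?thesis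
      using False assms FF_nth_0[of i j] by (auto simp: sFser_def FF_def unit_entry_def)
  qed (simp add: sFser_def sone_def)
qed

lemma sCn_eq_qdet: "sCn n s D E F m = qdet (\<lambda>i j. Abs_fps (sT s D E F i j)) $ m"
  unfolding sCn_def cdet_qdet ..

lemma Abs_fps_sT:
  "Abs_fps (sT s D E F i j) =
    (\<Sum>k=1..min i j. Abs_fps (sFser s F k i) * DD k * Abs_fps (sEser s E k j))"
proof (rule fps_ext)
  fix m
  have "smul (sFser s F k i) (smul (D k) (sEser s E k j)) m =
      (Abs_fps (sFser s F k i) * DD k * Abs_fps (sEser s E k j)) $ m" for k
    by (metis Abs_fps_smul DD_def fps_nth_Abs_fps mult.assoc)
  then show "Abs_fps (sT s D E F i j) $ m =
      (\<Sum>k=1..min i j. Abs_fps (sFser s F k i) * DD k * Abs_fps (sEser s E k j)) $ m"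
    by (simp add: sT_def fps_sum_nth)
qed

lemma sCn_eq_qdet_TT:
  assumes upper: "\<forall>i\<in>{1..n}. \<forall>j\<in>{1..n}. j < i \<longrightarrow> s i j = 0"
  shows "sCn n s D E F m = qdet TT $ m"
proof -
  \<comment> \<open>The common left factor F(u) D(u), extended by zero above the diagonal so that
    sums run to \<open>j\<close> instead of \<open>min i j\<close>.\<close>
  define G where "G i k = (if k \<le> i then FF k i * DD k else 0)" for i k
  have G: "(\<Sum>k=1..min i j. FF k i * DD k * g k) = (\<Sum>k=1..j. G i k * g k)" for i j g
  proof -
    have "{1..min i j} = {k \<in> {1..j}. k \<le> i}" by auto
    moreover have "(\<Sum>k \<in> {k \<in> {1..j}. k \<le> i}. FF k i * DD k * g k) =
        (\<Sum>k=1..j. if k \<le> i then FF k i * DD k * g k else 0)"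
      by (rule sum.inter_filter) simp
    ultimately show ?thesis by (auto simp: G_def intro!: sum.cong)
  qed
  have "qdet (\<lambda>i j. Abs_fps (sT s D E F i j)) = qdet TT"
  proof (rule qdet_triangular_factor)
    fix i j assume ij: "i \<in> {1..n}" "j \<in> {1..n}"
    show "TT i j = (\<Sum>k=1..j. G i k * EE k j)"
      unfolding TT_gauss[OF ij] G ..
    have "Abs_fps (sT s D E F i j) = (\<Sum>k=1..min i j. FF k i * DD k * Abs_fps (sEser s E k j))"
      unfolding Abs_fps_sT using ij by (intro sum.cong refl) (simp add: sFser_eq[OF upper])
    then show "Abs_fps (sT s D E F i j) = (\<Sum>k=1..j. G i k * Abs_fps (sEser s E k j))"
      unfolding G .
  next
    fix j
    show "EE j j = 1" by simp
    show "Abs_fps (sEser s E j j) = 1"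
      by (rule fps_ext) (simp add: sEser_def sone_def)
  qed
  then show ?thesis by (simp add: sCn_eq_qdet)
qed

text \<open>As a constant series the coefficient commutes with all T_kl(u), hence with all Gauss
  factors.\<close>

lemma qdet_commutes_gens:
  assumes "x \<in> shifted_gens n s D E F"
  shows "qdet TT $ m * x = x * qdet TT $ m"
proof -
  let ?z = "fps_const (qdet TT $ m)"
  have "?z * TT k l = TT k l * ?z" if "k \<in> {1..n}" "l \<in> {1..n}" for k l
    using qdet_central[OF that] by (simp add: fps_const_commute_iff TT_nth)
  note c = commutes_gauss[OF this, of n, simplified, unfolded fps_const_commute_iff]
  have "qdet TT $ m * D i r = D i r * qdet TT $ m" if "i \<in> {1..n}" for i r
    using c[of i] that by (simp add: DD_def)
  moreover have "qdet TT $ m * E i (Suc i) r = E i (Suc i) r * qdet TT $ m"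
      "qdet TT $ m * F i (Suc i) r = F i (Suc i) r * qdet TT $ m" if "1 \<le> i" "i < n" for i r
    using bspec[OF conjunct2[OF c[of i]], of "Suc i"] that by (simp_all add: EE_def FF_def unit_entry_def)
  ultimately show ?thesis
    using assms by (auto simp: shifted_gens_def)
qed

end

section \<open>The coefficients as elements of the shifted Yangian\<close>

section \<open>Membership in the shifted Yangian\<close>

lemma shift_matrix_Suc:
  assumes "shift_matrix n s" "1 \<le> i" "i \<le> j" "Suc j \<le> n"
  shows "s i j + s j (Suc j) = s i (Suc j)" and "s (Suc j) j + s j i = s (Suc j) i"
proof -
  have r: "i \<in> {1..n}" "j \<in> {1..n}" "Suc j \<in> {1..n}" using assms by auto
  have "\<bar>int i - int j\<bar> + \<bar>int j - int (Suc j)\<bar> = \<bar>int i - int (Suc j)\<bar>"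
    "\<bar>int (Suc j) - int j\<bar> + \<bar>int j - int i\<bar> = \<bar>int (Suc j) - int i\<bar>"
    using assms(3) by simp_all
  then show "s i j + s j (Suc j) = s i (Suc j)" and "s (Suc j) j + s j i = s (Suc j) i"
    using assms(1) r unfolding shift_matrix_def by blast+
qed

locale subalgebra =
  fixes emb :: "'f::field \<Rightarrow> 'a::ring_1" and S :: "'a set"
  assumes falg: "f_algebra emb"
begin

abbreviation "SA \<equiv> subalg emb S"

definition coeffs_in :: "'a fps \<Rightarrow> bool" where
  "coeffs_in f \<longleftrightarrow> (\<forall>m. f $ m \<in> SA)"

lemma one_in: "1 \<in> SA"
  using subalg.scal[of emb 1 S] falg by (simp add: f_algebra_def)

lemma zero_in: "0 \<in> SA"
  using subalg.add[OF one_in subalg.neg[OF one_in]] by simp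

lemma sum_in: "(\<And>i. i \<in> I \<Longrightarrow> f i \<in> SA) \<Longrightarrow> sum f I \<in> SA"
  by (induction I rule: infinite_finite_induct) (auto intro: zero_in subalg.add)

lemma of_nat_in: "of_nat k \<in> SA"
  by (induction k) (auto intro: zero_in one_in subalg.add)

lemma of_int_in: "of_int k \<in> SA"
  by (cases k) (auto intro: of_nat_in subalg.neg simp del: of_nat_Suc)

lemma diff_in: "x \<in> SA \<Longrightarrow> y \<in> SA \<Longrightarrow> x - y \<in> SA"
  using subalg.add[OF _ subalg.neg, of x emb S y] by simp

lemma coeffs_in_one: "coeffs_in 1"
  by (simp add: coeffs_in_def one_in zero_in)

lemma coeffs_in_mult: "coeffs_in f \<Longrightarrow> coeffs_in g \<Longrightarrow> coeffs_in (f * g)"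
  unfolding coeffs_in_def fps_mult_nth by (auto intro!: sum_in subalg.mult)

lemma coeffs_in_sum: "(\<And>i. i \<in> I \<Longrightarrow> coeffs_in (f i)) \<Longrightarrow> coeffs_in (sum f I)"
  unfolding coeffs_in_def fps_sum_nth by (auto intro!: sum_in)

lemma coeffs_in_prod_list: "(\<And>f. f \<in> set fs \<Longrightarrow> coeffs_in f) \<Longrightarrow> coeffs_in (prod_list fs)"
  by (induction fs) (auto intro: coeffs_in_one coeffs_in_mult)

lemma coeffs_in_fsh: "coeffs_in f \<Longrightarrow> coeffs_in (fsh c f)"
  unfolding coeffs_in_def fsh_nth sshift_def by (intro allI sum_in subalg.mult of_nat_in) auto

lemma coeffs_in_of_int: "coeffs_in (of_int k)"
  unfolding coeffs_in_def fps_of_int[symmetric] by (simp add: of_int_in zero_in)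

lemma coeffs_in_alt: "(\<And>w. w permutes {1..n} \<Longrightarrow> coeffs_in (g w)) \<Longrightarrow> coeffs_in (alt n g)"
  unfolding alt_def by (intro coeffs_in_sum coeffs_in_mult coeffs_in_of_int) auto

end

context yangian_gauss
begin

lemma sCn_in_subalg:
  assumes falg: "f_algebra emb" and shift: "shift_matrix n s"
  shows "sCn n s D E F m \<in> subalg emb (shifted_gens n s D E F)"
proof -
  interpret subalgebra emb "shifted_gens n s D E F"
    by standard (rule falg)
  have Dg: "D i r \<in> SA" if "i \<in> {1..n}" for i r
  proof (cases "r = 0")
    case True
    then show ?thesis using DD_nth_0[OF that] by (simp add: DD_def one_in)
  next
    case False
    then show ?thesis using that by (auto intro!: subalg.gen simp: shifted_gens_def)
  qed
  have Eg: "E i (Suc i) r \<in> SA" if "1 \<le> i" "i < n" "s i (Suc i) < r" for i r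
    using that by (auto intro!: subalg.gen simp: shifted_gens_def)
  have Fg: "F i (Suc i) r \<in> SA" if "1 \<le> i" "i < n" "s (Suc i) i < r" for i r
    using that by (auto intro!: subalg.gen simp: shifted_gens_def)
  have Ea: "sE_aux s E i d r \<in> SA" if "1 \<le> i" "i + d + 1 \<le> n" "s i (i + d + 1) < r" for i d r
    using that
  proof (induction d arbitrary: r)
    case (Suc d)
    let ?m = "i + d + 1"
    \<comment> \<open>Additivity turns the bound on \<open>r\<close> into the bound for the inner
      element of degree \<open>r - s ?m (Suc ?m)\<close>; the other entry has the lowest degree
      allowed for a generator.\<close>
    have "s i ?m + s ?m (Suc ?m) = s i (Suc ?m)"
      using shift_matrix_Suc(1)[OF shift, of i ?m] Suc.prems by simp
    then have "sE_aux s E i d (r - s ?m (Suc ?m)) \<in> SA"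
      using Suc by simp
    moreover have "E ?m (Suc ?m) (s ?m (Suc ?m) + 1) \<in> SA"
      using Eg Suc.prems by simp
    ultimately show ?case
      by (auto simp: Let_def intro!: diff_in subalg.mult)
  qed (simp add: Eg)
  have Fa: "sF_aux s F i d r \<in> SA" if "1 \<le> i" "i + d + 1 \<le> n" "s (i + d + 1) i < r" for i d r
    using that
  proof (induction d arbitrary: r)
    case (Suc d)
    let ?m = "i + d + 1"
    have "s (Suc ?m) ?m + s ?m i = s (Suc ?m) i"
      using shift_matrix_Suc(2)[OF shift, of i ?m] Suc.prems by simp
    then have "sF_aux s F i d (r - s (Suc ?m) ?m) \<in> SA"
      using Suc by simp
    moreover have "F ?m (Suc ?m) (s (Suc ?m) ?m + 1) \<in> SA"
      using Fg Suc.prems by simp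
    ultimately show ?case
      by (auto simp: Let_def intro!: diff_in subalg.mult)
  qed (simp add: Fg)
  have ser: "coeffs_in (DD i)" "coeffs_in (Abs_fps (sEser s E i j))" "coeffs_in (Abs_fps (sFser s F i j))"
    if "1 \<le> i" "i \<le> j" "j \<le> n" for i j
    using that Dg Ea[of i "j - i - 1"] Fa[of i "j - i - 1"]
    by (auto simp: coeffs_in_def DD_def sEser_def sFser_def sone_def one_in zero_in)
  have "coeffs_in (Abs_fps (sT s D E F i j))" if "i \<in> {1..n}" "j \<in> {1..n}" for i j
    unfolding Abs_fps_sT using that ser
    by (intro coeffs_in_sum coeffs_in_mult) auto
  then have "coeffs_in (qdet (\<lambda>i j. Abs_fps (sT s D E F i j)))"
    unfolding qdet_def using permutes_range
    by (intro coeffs_in_alt coeffs_in_prod_list) (auto intro!: coeffs_in_fsh)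
  then show ?thesis
    by (simp add: sCn_eq_qdet coeffs_in_def)
qed

end

section \<open>Equality of the two determinants and centrality in the shifted Yangian\<close>

theorem theorem2p2:
  fixes emb :: "'f::field_char_0 \<Rightarrow> 'a::ring_1"
    and n :: nat
    and t :: "nat \<Rightarrow> nat \<Rightarrow> nat \<Rightarrow> 'a"
    and s :: "nat \<Rightarrow> nat \<Rightarrow> nat"
    and D :: "nat \<Rightarrow> nat \<Rightarrow> 'a"
    and E F :: "nat \<Rightarrow> nat \<Rightarrow> nat \<Rightarrow> 'a"
  assumes alg_closed: "\<forall>p :: 'f poly. 0 < degree p \<longrightarrow> (\<exists>x. poly p x = 0)"
    and falg: "f_algebra emb"
    and rel: "yangian_rel n t"
    and gauss: "gauss n (Tc t) D E F"
    and shift: "shift_matrix n s"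
    and upper: "\<forall>i\<in>{1..n}. \<forall>j\<in>{1..n}. j < i \<longrightarrow> s i j = 0"
  shows "(\<forall>m. sCn n s D E F m = Cn n (Tc t) m) \<and>
         (\<forall>m. sCn n s D E F m \<in> subalg emb (shifted_gens n s D E F) \<and>
              (\<forall>x\<in>subalg emb (shifted_gens n s D E F).
                  sCn n s D E F m * x = x * sCn n s D E F m))"
proof -
  interpret yangian_gauss n t D E F
    by standard (fact rel gauss)+
  \<comment> \<open>Both determinants are identified with \<open>qdet TT\<close>, whose coefficients
    commute with the generators.\<close>
  note C = sCn_eq_qdet_TT[OF upper]
  have "sCn n s D E F m = Cn n (Tc t) m" for m
    unfolding C Cn_def cdet_qdet TT_def[abs_def] ..
  moreover have "sCn n s D E F m * x = x * sCn n s D E F m"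
    if "x \<in> subalg emb (shifted_gens n s D E F)" for m x
    using that
  proof induction
    case (gen x)
    then show ?case unfolding C by (rule qdet_commutes_gens)
  next
    case (scal c)
    then show ?case using falg by (simp add: f_algebra_def)
  next
    case (mult x y)
    then show ?case by (metis mult.assoc)
  qed (simp_all add: distrib_left distrib_right)
  ultimately show ?thesis
    using sCn_in_subalg[OF falg shift] by blast
qed

end
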